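(* Let $\mathcal V$ be a commutative quantale, $T:\mathsf{Set}\to\mathsf{Set}$ an arbitrary endofunctor, $\widehat T:\mathsf{Preord}\to\mathsf{Preord}$ a lifting of $T$ to $\mathsf{Preord}$, and $\overline T:\mathcal V\text{-}\mathsf{cat}\to\mathcal V\text{-}\mathsf{cat}$ a lifting of $\widehat T$ to $\mathcal V\text{-}\mathsf{cat}$. Then the ordinary adjunction $D_o\dashv V$ (with $V:\mathsf{Preord}\to\mathsf{Set}$) and the $\mathsf{Preord}$-adjunction $\mathsf d_*\dashv\mathsf u_*$ (with $\mathsf u_*:\mathcal V\text{-}\mathsf{cat}\to\mathsf{Preord}$) lift to adjunctions between the associated categories of coalgebras: an ordinary adjunction $\widetilde D_o\dashv\widetilde V$ with $\widetilde V:\mathsf{Coalg}(\widehat T)\to\mathsf{Coalg}(T)$, and a $\mathsf{Preord}$-enriched adjunction $\widetilde{\mathsf d}_*\dashv\widetilde{\mathsf u}_*$ with $\widetilde{\mathsf u}_*:\mathsf{Coalg}(\overline T)\to\mathsf{Coalg}(\widehat T)$, whose functors commute with the forgetful functors from coalgebras to $\mathsf{Set}$, $\mathsf{Preord}$ and $\mathcal V\text{-}\mathsf{cat}$, respectively.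
   Context: $\mathcal V=(\mathcal V_o,\otimes,e,[-,-])$ is a commutative quantale: a complete lattice with a commutative, associative, monotone operation $\otimes$ with unit $e$, such that each $-\otimes r$ has a right adjoint $[r,-]$; $\mathcal V$ is assumed non-trivial ($e\neq\bot$). A (small) $\mathcal V$-category $\mathcal X$ is a set of objects together with elements $\mathcal X(x',x)\in\mathcal V_o$ satisfying $e\le\mathcal X(x,x)$ and $\mathcal X(x',x)\otimes\mathcal X(x'',x')\le\mathcal X(x'',x)$; a $\mathcal V$-functor $f:\mathcal X\to\mathcal Y$ is a map on objects with $\mathcal X(x',x)\le\mathcal Y(fx',fx)$. $\mathcal V\text{-}\mathsf{cat}$ is the category of small $\mathcal V$-categories, enriched over itself with hom $[\mathcal Y,\mathcal Z](f,g)=\bigwedge_y\mathcal Z(fy,gy)$. $\mathsf{Preord}=\mathbb 2\text{-}\mathsf{cat}$ is the category of preorders and monotone maps, enriched over itself by the pointwise order. Every $\mathcal V\text{-}\mathsf{cat}$-category (and functor) is $\mathsf{Preord}$-enriched via the order $f\le g$ iff $e\le\mathbb X(X,Y)(f,g)$. $V:\mathsf{Preord}\to\mathsf{Set}$ is the (ordinary) underlying set functor, with left adjoint $D_o$ the discrete preorder functor. $\mathsf d_*:\mathsf{Preord}\to\mathcal V\text{-}\mathsf{cat}$ sends a preorder $X$ to the $\mathcal V$-category with the same objects and $\mathsf d_*X(x',x)=e$ if $x'\le x$, $\bot$ otherwise; its right adjoint $\mathsf u_*$ sends $\mathcal X$ to the preorder on the same objects with $x'\le x$ iff $e\le\mathcal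 X(x',x)$. The adjunction $\mathsf d_*\dashv\mathsf u_*$ is $\mathsf{Preord}$-enriched. A lifting of $T$ to $\mathsf{Preord}$ is a locally monotone (i.e. $\mathsf{Preord}$-enriched) functor $\widehat T$ together with a natural isomorphism $TV\cong V\widehat T$ of ordinary functors. A lifting of $\widehat T$ to $\mathcal V\text{-}\mathsf{cat}$ is a $\mathcal V\text{-}\mathsf{cat}$-functor $\overline T$ together with a natural isomorphism $\mathsf u_*\overline T\cong\widehat T\mathsf u_*$ of $\mathsf{Preord}$-functors. For an endofunctor $S$ of $\mathbb X$, $\mathsf{Coalg}(S)$ has objects the pairs $(X,c:X\to SX)$ and morphisms $(X,c)\to(Y,d)$ the $f:X\to Y$ with $d\circ f=S(f)\circ c$, with enrichment (if any) inherited from $\mathbb X(X,Y)$; the forgetful functor sends $(X,c)$ to $X$. *)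

theory Defs
  imports Main "HOL-Library.FuncSet"
begin

section \<open>Quantales, quantale-enriched categories\<close>

class comm_quantale = complete_lattice + comm_monoid_mult +
  fixes resid :: "'a \<Rightarrow> 'a \<Rightarrow> 'a"
  assumes mult_mono_quantale: "x \<le> x' \<Longrightarrow> y \<le> y' \<Longrightarrow> x * y \<le> x' * y'"
    and resid_adjoint: "x * r \<le> y \<longleftrightarrow> x \<le> resid r y"

text \<open>\<open>h x' x\<close> is the hom-value from \<open>x'\<close> to \<open>x\<close>.\<close>

definition v_category :: "'a set \<Rightarrow> ('a \<Rightarrow> 'a \<Rightarrow> 'v::comm_quantale) \<Rightarrow> bool" where
  "v_category A h \<longleftrightarrow>
     (\<forall>x\<in>A. 1 \<le> h x x) \<and>
     (\<forall>x\<in>A. \<forall>x'\<in>A. \<forall>x''\<in>A. h x' x * h x'' x' \<le> h x'' x)"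

definition v_functor ::
  "'a set \<Rightarrow> ('a \<Rightarrow> 'a \<Rightarrow> 'v::comm_quantale) \<Rightarrow> 'b set \<Rightarrow> ('b \<Rightarrow> 'b \<Rightarrow> 'v) \<Rightarrow> ('a \<Rightarrow> 'b) \<Rightarrow> bool" where
  "v_functor A h B k f \<longleftrightarrow> f \<in> A \<rightarrow> B \<and> (\<forall>x'\<in>A. \<forall>x\<in>A. h x' x \<le> k (f x') (f x))"

definition underlying_order :: "'a set \<Rightarrow> ('a \<Rightarrow> 'a \<Rightarrow> 'v::comm_quantale) \<Rightarrow> 'a rel" where
  "underlying_order A h = {(x', x). x' \<in> A \<and> x \<in> A \<and> 1 \<le> h x' x}"


section \<open>Categories, functors, natural transformations, adjunctions\<close>

text \<open>
  Morphisms need not determine their domain and codomain, so composition and the action of a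
  functor on morphisms carry the objects as indices: \<open>Cmp C X Y Z g f\<close> is the composite of
  \<open>f : X \<rightarrow> Y\<close> and \<open>g : Y \<rightarrow> Z\<close>.  Values at arguments outside \<open>Obj\<close> and \<open>Hom\<close> are irrelevant.
\<close>

record ('o, 'm) cat =
  Obj :: "'o set"
  Hom :: "'o \<Rightarrow> 'o \<Rightarrow> 'm set"
  Ident :: "'o \<Rightarrow> 'm"
  Cmp :: "'o \<Rightarrow> 'o \<Rightarrow> 'o \<Rightarrow> 'm \<Rightarrow> 'm \<Rightarrow> 'm"

record ('o, 'm) pcat = "('o, 'm) cat" +
  HomOrd :: "'o \<Rightarrow> 'o \<Rightarrow> 'm rel"

record ('o, 'm, 'v) vcat = "('o, 'm) cat" +
  HomV :: "'o \<Rightarrow> 'o \<Rightarrow> 'm \<Rightarrow> 'm \<Rightarrow> 'v"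

record ('o, 'm, 'p, 'n) fctr =
  omap :: "'o \<Rightarrow> 'p"
  amap :: "'o \<Rightarrow> 'o \<Rightarrow> 'm \<Rightarrow> 'n"

locale category =
  fixes C :: "('o, 'm, 'x) cat_scheme"
  assumes Ident_in: "X \<in> Obj C \<Longrightarrow> Ident C X \<in> Hom C X X"
    and Cmp_in: "\<lbrakk>X \<in> Obj C; Y \<in> Obj C; Z \<in> Obj C; f \<in> Hom C X Y; g \<in> Hom C Y Z\<rbrakk>
      \<Longrightarrow> Cmp C X Y Z g f \<in> Hom C X Z"
    and Cmp_Ident_right: "\<lbrakk>X \<in> Obj C; Y \<in> Obj C; f \<in> Hom C X Y\<rbrakk>
      \<Longrightarrow> Cmp C X X Y f (Ident C X) = f"
    and Cmp_Ident_left: "\<lbrakk>X \<in> Obj C; Y \<in> Obj C; f \<in> Hom C X Y\<rbrakk>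
      \<Longrightarrow> Cmp C X Y Y (Ident C Y) f = f"
    and Cmp_assoc: "\<lbrakk>W \<in> Obj C; X \<in> Obj C; Y \<in> Obj C; Z \<in> Obj C;
        f \<in> Hom C W X; g \<in> Hom C X Y; h \<in> Hom C Y Z\<rbrakk>
      \<Longrightarrow> Cmp C W Y Z h (Cmp C W X Y g f) = Cmp C W X Z (Cmp C X Y Z h g) f"

locale preord_category = category C
  for C :: "('o, 'm, 'x) pcat_scheme" +
  assumes HomOrd_preorder: "\<lbrakk>X \<in> Obj C; Y \<in> Obj C\<rbrakk> \<Longrightarrow> preorder_on (Hom C X Y) (HomOrd C X Y)"
    and Cmp_mono: "\<lbrakk>X \<in> Obj C; Y \<in> Obj C; Z \<in> Obj C;
        (f, f') \<in> HomOrd C X Y; (g, g') \<in> HomOrd C Y Z\<rbrakk>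
      \<Longrightarrow> (Cmp C X Y Z g f, Cmp C X Y Z g' f') \<in> HomOrd C X Z"

text \<open>
  In a category enriched in quantale-enriched categories, composition is enriched out of the tensor product
  of the hom-objects; the enrichment of the identities is the reflexivity of the hom-objects.
\<close>

locale vcat_category = category C
  for C :: "('o, 'm, 'v::comm_quantale, 'x) vcat_scheme" +
  assumes HomV_category: "\<lbrakk>X \<in> Obj C; Y \<in> Obj C\<rbrakk> \<Longrightarrow> v_category (Hom C X Y) (HomV C X Y)"
    and Cmp_enriched: "\<lbrakk>X \<in> Obj C; Y \<in> Obj C; Z \<in> Obj C;
        f \<in> Hom C X Y; f' \<in> Hom C X Y; g \<in> Hom C Y Z; g' \<in> Hom C Y Z\<rbrakk>
      \<Longrightarrow> HomV C Y Z g g' * HomV C X Y f f' \<le> HomV C X Z (Cmp C X Y Z g f) (Cmp C X Y Z g' f')"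

definition underlying_pcat :: "('o, 'm, 'v::comm_quantale) vcat \<Rightarrow> ('o, 'm) pcat" where
  "underlying_pcat C = cat.extend (cat.truncate C)
     (pcat.fields (\<lambda>X Y. underlying_order (Hom C X Y) (HomV C X Y)))"

locale cat_functor = C: category C + D: category D
  for C :: "('o, 'm, 'x) cat_scheme"
    and D :: "('p, 'n, 'y) cat_scheme"
    and F :: "('o, 'm, 'p, 'n) fctr" +
  assumes omap_in: "X \<in> Obj C \<Longrightarrow> omap F X \<in> Obj D"
    and amap_in: "\<lbrakk>X \<in> Obj C; Y \<in> Obj C; f \<in> Hom C X Y\<rbrakk>
      \<Longrightarrow> amap F X Y f \<in> Hom D (omap F X) (omap F Y)"
    and amap_Ident: "X \<in> Obj C \<Longrightarrow> amap F X X (Ident C X) = Ident D (omap F X)"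
    and amap_Cmp: "\<lbrakk>X \<in> Obj C; Y \<in> Obj C; Z \<in> Obj C; f \<in> Hom C X Y; g \<in> Hom C Y Z\<rbrakk>
      \<Longrightarrow> amap F X Z (Cmp C X Y Z g f)
        = Cmp D (omap F X) (omap F Y) (omap F Z) (amap F Y Z g) (amap F X Y f)"

locale preord_functor = cat_functor C D F + C: preord_category C + D: preord_category D
  for C :: "('o, 'm, 'x) pcat_scheme"
    and D :: "('p, 'n, 'y) pcat_scheme"
    and F :: "('o, 'm, 'p, 'n) fctr" +
  assumes amap_mono: "\<lbrakk>X \<in> Obj C; Y \<in> Obj C; (f, g) \<in> HomOrd C X Y\<rbrakk>
      \<Longrightarrow> (amap F X Y f, amap F X Y g) \<in> HomOrd D (omap F X) (omap F Y)"

locale vcat_functor = cat_functor C D F + C: vcat_category C + D: vcat_category D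
  for C :: "('o, 'm, 'v::comm_quantale, 'x) vcat_scheme"
    and D :: "('p, 'n, 'v, 'y) vcat_scheme"
    and F :: "('o, 'm, 'p, 'n) fctr" +
  assumes amap_enriched: "\<lbrakk>X \<in> Obj C; Y \<in> Obj C\<rbrakk>
      \<Longrightarrow> v_functor (Hom C X Y) (HomV C X Y)
            (Hom D (omap F X) (omap F Y)) (HomV D (omap F X) (omap F Y)) (amap F X Y)"

definition id_fctr :: "('o, 'm, 'o, 'm) fctr" where
  "id_fctr = \<lparr>omap = (\<lambda>X. X), amap = (\<lambda>X Y f. f)\<rparr>"

definition comp_fctr ::
  "('p, 'n, 'q, 'l) fctr \<Rightarrow> ('o, 'm, 'p, 'n) fctr \<Rightarrow> ('o, 'm, 'q, 'l) fctr" where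
  "comp_fctr G F =
     \<lparr>omap = (\<lambda>X. omap G (omap F X)),
      amap = (\<lambda>X Y f. amap G (omap F X) (omap F Y) (amap F X Y f))\<rparr>"

definition fctr_eq_on ::
  "('o, 'm, 'x) cat_scheme \<Rightarrow> ('o, 'm, 'p, 'n) fctr \<Rightarrow> ('o, 'm, 'p, 'n) fctr \<Rightarrow> bool" where
  "fctr_eq_on C F G \<longleftrightarrow>
     (\<forall>X\<in>Obj C. omap F X = omap G X) \<and>
     (\<forall>X\<in>Obj C. \<forall>Y\<in>Obj C. \<forall>f\<in>Hom C X Y. amap F X Y f = amap G X Y f)"

definition iso_in :: "('o, 'm, 'x) cat_scheme \<Rightarrow> 'o \<Rightarrow> 'o \<Rightarrow> 'm \<Rightarrow> bool" where
  "iso_in C X Y f \<longleftrightarrow> f \<in> Hom C X Y \<and>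
     (\<exists>g\<in>Hom C Y X. Cmp C X Y X g f = Ident C X \<and> Cmp C Y X Y f g = Ident C Y)"

locale nat_trans = F: cat_functor C D F + G: cat_functor C D G
  for C :: "('o, 'm, 'x) cat_scheme"
    and D :: "('p, 'n, 'y) cat_scheme"
    and F G :: "('o, 'm, 'p, 'n) fctr"
    and \<alpha> :: "'o \<Rightarrow> 'n" +
  assumes component_in: "X \<in> Obj C \<Longrightarrow> \<alpha> X \<in> Hom D (omap F X) (omap G X)"
    and naturality: "\<lbrakk>X \<in> Obj C; Y \<in> Obj C; f \<in> Hom C X Y\<rbrakk>
      \<Longrightarrow> Cmp D (omap F X) (omap F Y) (omap G Y) (\<alpha> Y) (amap F X Y f)
        = Cmp D (omap F X) (omap G X) (omap G Y) (amap G X Y f) (\<alpha> X)"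

locale nat_iso = nat_trans +
  assumes component_iso: "X \<in> Obj C \<Longrightarrow> iso_in D (omap F X) (omap G X) (\<alpha> X)"

text \<open>
  For enrichment in preorders, a natural transformation between enriched functors carries no
  condition beyond ordinary naturality, and likewise for the unit and counit of an adjunction.
\<close>

locale preord_nat_iso = nat_iso C D F G \<alpha> + F: preord_functor C D F + G: preord_functor C D G
  for C :: "('o, 'm, 'x) pcat_scheme"
    and D :: "('p, 'n, 'y) pcat_scheme"
    and F G :: "('o, 'm, 'p, 'n) fctr"
    and \<alpha> :: "'o \<Rightarrow> 'n"

text \<open>\<open>F : C \<rightarrow> D\<close> is left adjoint to \<open>G : D \<rightarrow> C\<close>, with unit \<open>\<eta>\<close> and counit \<open>\<epsilon>\<close>.\<close>

locale adjunction =
  F: cat_functor C D F + G: cat_functor D C G +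
  unit: nat_trans C C id_fctr "comp_fctr G F" \<eta> +
  counit: nat_trans D D "comp_fctr F G" id_fctr \<epsilon>
  for C :: "('o, 'm, 'x) cat_scheme"
    and D :: "('p, 'n, 'y) cat_scheme"
    and F :: "('o, 'm, 'p, 'n) fctr"
    and G :: "('p, 'n, 'o, 'm) fctr"
    and \<eta> :: "'o \<Rightarrow> 'm"
    and \<epsilon> :: "'p \<Rightarrow> 'n" +
  assumes triangle_left: "X \<in> Obj C \<Longrightarrow>
      Cmp D (omap F X) (omap F (omap G (omap F X))) (omap F X)
        (\<epsilon> (omap F X)) (amap F X (omap G (omap F X)) (\<eta> X)) = Ident D (omap F X)"
    and triangle_right: "Y \<in> Obj D \<Longrightarrow>
      Cmp C (omap G Y) (omap G (omap F (omap G Y))) (omap G Y)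
        (amap G (omap F (omap G Y)) Y (\<epsilon> Y)) (\<eta> (omap G Y)) = Ident C (omap G Y)"

locale preord_adjunction =
  adjunction C D F G \<eta> \<epsilon> + F: preord_functor C D F + G: preord_functor D C G
  for C :: "('o, 'm, 'x) pcat_scheme"
    and D :: "('p, 'n, 'y) pcat_scheme"
    and F :: "('o, 'm, 'p, 'n) fctr"
    and G :: "('p, 'n, 'o, 'm) fctr"
    and \<eta> :: "'o \<Rightarrow> 'm"
    and \<epsilon> :: "'p \<Rightarrow> 'n"

text \<open>
  The adjunction on \<open>C'\<close>, \<open>D'\<close> lies strictly over the one on \<open>C\<close>, \<open>D\<close> along the functors
  \<open>P : C' \<rightarrow> C\<close> and \<open>Q : D' \<rightarrow> D\<close>: both adjoints commute with \<open>P\<close> and \<open>Q\<close>, and \<open>P\<close>, \<open>Q\<close> send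
  unit to unit and counit to counit (a map of adjunctions).
\<close>

locale adjunction_lift =
  base: adjunction C D F G \<eta> \<epsilon> + lifted: adjunction C' D' F' G' \<eta>' \<epsilon>' +
  P: cat_functor C' C P + Q: cat_functor D' D Q
  for C :: "('o, 'm, 'x) cat_scheme"
    and D :: "('p, 'n, 'y) cat_scheme"
    and F G \<eta> \<epsilon>
    and C' :: "('o', 'm', 'x') cat_scheme"
    and D' :: "('p', 'n', 'y') cat_scheme"
    and F' G' \<eta>' \<epsilon>' P Q +
  assumes left_commutes: "fctr_eq_on C' (comp_fctr Q F') (comp_fctr F P)"
    and right_commutes: "fctr_eq_on D' (comp_fctr P G') (comp_fctr G Q)"
    and unit_over: "X \<in> Obj C' \<Longrightarrow> amap P X (omap G' (omap F' X)) (\<eta>' X) = \<eta> (omap P X)"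
    and counit_over: "Y \<in> Obj D' \<Longrightarrow> amap Q (omap F' (omap G' Y)) Y (\<epsilon>' Y) = \<epsilon> (omap Q Y)"

locale preord_adjunction_lift =
  adjunction_lift C D F G \<eta> \<epsilon> C' D' F' G' \<eta>' \<epsilon>' P Q +
  base: preord_adjunction C D F G \<eta> \<epsilon> + lifted: preord_adjunction C' D' F' G' \<eta>' \<epsilon>' +
  P: preord_functor C' C P + Q: preord_functor D' D Q
  for C :: "('o, 'm, 'x) pcat_scheme"
    and D :: "('p, 'n, 'y) pcat_scheme"
    and F G \<eta> \<epsilon>
    and C' :: "('o', 'm', 'x') pcat_scheme"
    and D' :: "('p', 'n', 'y') pcat_scheme"
    and F' G' \<eta>' \<epsilon>' P Q


section \<open>The categories of sets, preorders and quantale-enriched categories\<close>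

text \<open>
  HOL has no type of all sets, so \<open>Set\<close> is relative to a universe \<open>U\<close> of small sets with elements
  in an arbitrary type.  No closure property of \<open>U\<close> is assumed, so \<open>U\<close> may be taken to be any
  Grothendieck universe modelled in a type, or \<open>UNIV\<close>.  Preorders and quantale-enriched categories
  are small if their sets of objects belong to \<open>U\<close>.  Maps are extensional functions, so that
  equality of maps is equality on the domain; for the same reason hom-functions of
  quantale-enriched categories are extensional.
\<close>

definition set_cat :: "'u set set \<Rightarrow> ('u set, 'u \<Rightarrow> 'u) cat" where
  "set_cat U =
     \<lparr>Obj = U,
      Hom = (\<lambda>A B. A \<rightarrow>\<^sub>E B),
      Ident = (\<lambda>A. \<lambda>x\<in>A. x),
      Cmp = (\<lambda>A B C g f. compose A g f)\<rparr>"

type_synonym 'u preord = "'u set \<times> 'u rel"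

definition monotone_maps :: "'u preord \<Rightarrow> 'u preord \<Rightarrow> ('u \<Rightarrow> 'u) set" where
  "monotone_maps = (\<lambda>(A, r) (B, s). {f \<in> A \<rightarrow>\<^sub>E B. \<forall>(x', x)\<in>r. (f x', f x) \<in> s})"

definition preord_cat :: "'u set set \<Rightarrow> ('u preord, 'u \<Rightarrow> 'u) pcat" where
  "preord_cat U =
     \<lparr>Obj = {(A, r). A \<in> U \<and> preorder_on A r},
      Hom = monotone_maps,
      Ident = (\<lambda>(A, r). \<lambda>x\<in>A. x),
      Cmp = (\<lambda>(A, r) Y Z g f. compose A g f),
      HomOrd = (\<lambda>X Y.
        {(f, g). f \<in> monotone_maps X Y \<and> g \<in> monotone_maps X Y \<and>
                 (\<forall>x\<in>fst X. (f x, g x) \<in> snd Y)})\<rparr>"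

type_synonym ('u, 'v) small_vcat = "'u set \<times> ('u \<Rightarrow> 'u \<Rightarrow> 'v)"

definition v_cat :: "'u set set \<Rightarrow> (('u, 'v::comm_quantale) small_vcat, 'u \<Rightarrow> 'u, 'v) vcat" where
  "v_cat U =
     \<lparr>Obj = {(A, h). A \<in> U \<and> v_category A h \<and> case_prod h \<in> extensional (A \<times> A)},
      Hom = (\<lambda>(A, h) (B, k). {f \<in> A \<rightarrow>\<^sub>E B. v_functor A h B k f}),
      Ident = (\<lambda>(A, h). \<lambda>x\<in>A. x),
      Cmp = (\<lambda>(A, h) Y Z g f. compose A g f),
      HomV = (\<lambda>(A, h) (B, k) f g. INF x\<in>A. k (f x) (g x))\<rparr>"

definition V_fctr :: "('u preord, 'u \<Rightarrow> 'u, 'u set, 'u \<Rightarrow> 'u) fctr" where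
  "V_fctr = \<lparr>omap = (\<lambda>(A, r). A), amap = (\<lambda>X Y f. f)\<rparr>"

definition Do_fctr :: "('u set, 'u \<Rightarrow> 'u, 'u preord, 'u \<Rightarrow> 'u) fctr" where
  "Do_fctr = \<lparr>omap = (\<lambda>A. (A, Id_on A)), amap = (\<lambda>X Y f. f)\<rparr>"

definition u_fctr :: "(('u, 'v::comm_quantale) small_vcat, 'u \<Rightarrow> 'u, 'u preord, 'u \<Rightarrow> 'u) fctr" where
  "u_fctr = \<lparr>omap = (\<lambda>(A, h). (A, underlying_order A h)), amap = (\<lambda>X Y f. f)\<rparr>"

definition d_fctr :: "('u preord, 'u \<Rightarrow> 'u, ('u, 'v::comm_quantale) small_vcat, 'u \<Rightarrow> 'u) fctr" where
  "d_fctr =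
     \<lparr>omap = (\<lambda>(A, r). (A, curry (\<lambda>(x', x)\<in>A \<times> A. if (x', x) \<in> r then 1 else bot))),
      amap = (\<lambda>X Y f. f)\<rparr>"

text \<open>The units and counits of \<open>D\<^sub>o \<stileturn> V\<close> and \<open>d\<^sub>* \<stileturn> u\<^sub>*\<close> are identities on elements.\<close>

definition id_on_set :: "'u set \<Rightarrow> 'u \<Rightarrow> 'u" where
  "id_on_set A = (\<lambda>x\<in>A. x)"

definition id_on_carrier :: "'u set \<times> 'b \<Rightarrow> 'u \<Rightarrow> 'u" where
  "id_on_carrier X = (\<lambda>x\<in>fst X. x)"


section \<open>Liftings\<close>

locale preord_lifting =
  That: preord_functor "preord_cat U" "preord_cat U" That +
  iso: nat_iso "preord_cat U" "set_cat U" "comp_fctr T V_fctr" "comp_fctr V_fctr That" \<alpha>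
  for U :: "'u set set" and T That \<alpha>

locale v_cat_lifting =
  Tbar: vcat_functor "v_cat U" "v_cat U" Tbar +
  iso: preord_nat_iso "underlying_pcat (v_cat U)" "preord_cat U"
    "comp_fctr u_fctr Tbar" "comp_fctr That u_fctr" \<beta>
  for U :: "'u set set"
    and That
    and Tbar :: "(('u, 'v::comm_quantale) small_vcat, 'u \<Rightarrow> 'u,
                  ('u, 'v) small_vcat, 'u \<Rightarrow> 'u) fctr"
    and \<beta>


section \<open>Coalgebras\<close>

definition coalg ::
  "('o, 'm, 'x) cat_scheme \<Rightarrow> ('o, 'm, 'o, 'm) fctr \<Rightarrow> ('o \<times> 'm, 'm) cat" where
  "coalg C S =
     \<lparr>Obj = {(X, c). X \<in> Obj C \<and> c \<in> Hom C X (omap S X)},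
      Hom = (\<lambda>(X, c) (Y, d).
        {f \<in> Hom C X Y.
          Cmp C X Y (omap S Y) d f = Cmp C X (omap S X) (omap S Y) (amap S X Y f) c}),
      Ident = (\<lambda>(X, c). Ident C X),
      Cmp = (\<lambda>(X, c) (Y, d) (Z, e). Cmp C X Y Z)\<rparr>"

definition preord_coalg ::
  "('o, 'm, 'x) pcat_scheme \<Rightarrow> ('o, 'm, 'o, 'm) fctr \<Rightarrow> ('o \<times> 'm, 'm) pcat" where
  "preord_coalg C S = cat.extend (coalg C S)
     (pcat.fields (\<lambda>X Y. HomOrd C (fst X) (fst Y) \<inter> (Hom (coalg C S) X Y \<times> Hom (coalg C S) X Y)))"

definition vcat_coalg ::
  "('o, 'm, 'v, 'x) vcat_scheme \<Rightarrow> ('o, 'm, 'o, 'm) fctr \<Rightarrow> ('o \<times> 'm, 'm, 'v) vcat" where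
  "vcat_coalg C S = cat.extend (coalg C S) (vcat.fields (\<lambda>X Y. HomV C (fst X) (fst Y)))"

definition forget_fctr :: "('o \<times> 'm, 'm, 'o, 'm) fctr" where
  "forget_fctr = \<lparr>omap = fst, amap = (\<lambda>X Y f. f)\<rparr>"

end

theory Submission
  imports Defs
begin

text \<open>
  Let \<open>F \<stileturn> G\<close> be an adjunction between \<open>C\<close> and \<open>D\<close>, and \<open>S\<close>, \<open>R\<close> endofunctors of \<open>C\<close>, \<open>D\<close> with
  \<open>\<gamma> : S G \<cong> G R\<close>.  A coalgebra \<open>d : Y \<rightarrow> R Y\<close> yields \<open>\<gamma>\<inverse> \<circ> G d : G Y \<rightarrow> S G Y\<close>, and a coalgebra
  \<open>c : X \<rightarrow> S X\<close> yields the transpose \<open>F X \<rightarrow> R F X\<close> of \<open>\<gamma> \<circ> S \<eta> \<circ> c : X \<rightarrow> S G F X \<cong> G R F X\<close>.  On morphisms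
  both assignments act as \<open>G\<close> and \<open>F\<close>, and the original unit and counit are coalgebra morphisms, so
  the adjunction lifts; local monotonicity is inherited.  A lifting of functors is exactly such
  an intertwining isomorphism for \<open>V\<close> or \<open>u\<^sub>*\<close>.
\<close>

section \<open>Transposition along an adjunction\<close>

lemma comp_fctr_simps [simp]:
  "omap (comp_fctr G F) X = omap G (omap F X)"
  "amap (comp_fctr G F) X Y f = amap G (omap F X) (omap F Y) (amap F X Y f)"
  by (simp_all add: comp_fctr_def)

lemma id_fctr_simps [simp]:
  "omap id_fctr X = X"
  "amap id_fctr X Y f = f"
  by (simp_all add: id_fctr_def)

lemma forget_fctr_simps [simp]:
  "omap forget_fctr X = fst X"
  "amap forget_fctr X Y f = f"
  by (simp_all add: forget_fctr_def)

context adjunction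
begin

text \<open>One direction of the bijection between \<open>Hom C X (omap G Y)\<close> and
  \<open>Hom D (omap F X) Y\<close>. The inverse sends g to G g after \<eta>;
  \<open>amap_transpose_unit\<close> is the half of the inverse law that the lifting uses.\<close>

definition transpose :: "'o \<Rightarrow> 'p \<Rightarrow> 'm \<Rightarrow> 'n" where
  "transpose X Y f = Cmp D (omap F X) (omap F (omap G Y)) Y (\<epsilon> Y) (amap F X (omap G Y) f)"

lemma unit_in: "X \<in> Obj C \<Longrightarrow> \<eta> X \<in> Hom C X (omap G (omap F X))"
  using unit.component_in[of X] by simp

lemma counit_in: "Y \<in> Obj D \<Longrightarrow> \<epsilon> Y \<in> Hom D (omap F (omap G Y)) Y"
  using counit.component_in[of Y] by simp

text \<open>Associativity and the functor laws are conditional on membership in objects and homs;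
  these rules let the simplifier discharge those conditions.\<close>

lemmas hom_in = F.omap_in G.omap_in F.amap_in G.amap_in F.C.Cmp_in F.D.Cmp_in
  F.C.Ident_in F.D.Ident_in unit_in counit_in

lemma transpose_in:
  assumes "X \<in> Obj C" "Y \<in> Obj D" "f \<in> Hom C X (omap G Y)"
  shows "transpose X Y f \<in> Hom D (omap F X) Y"
  unfolding transpose_def using assms by (simp add: hom_in)

text \<open>Naturality of transposition in the first argument: F preserves composition, and the rest
  is associativity.\<close>

lemma transpose_Cmp_right:
  assumes "X' \<in> Obj C" "X \<in> Obj C" "Y \<in> Obj D" "h \<in> Hom C X' X" "f \<in> Hom C X (omap G Y)"
  shows "transpose X' Y (Cmp C X' X (omap G Y) f h)
    = Cmp D (omap F X') (omap F X) Y (transpose X Y f) (amap F X' X h)"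
  unfolding transpose_def using assms by (simp add: hom_in F.amap_Cmp F.D.Cmp_assoc)

text \<open>Naturality of transposition in the second argument: naturality of \<epsilon> exchanges F
  G g for g.\<close>

lemma transpose_Cmp_left:
  assumes "X \<in> Obj C" "Y \<in> Obj D" "Z \<in> Obj D" "f \<in> Hom C X (omap G Y)" "g \<in> Hom D Y Z"
  shows "transpose X Z (Cmp C X (omap G Y) (omap G Z) (amap G Y Z g) f)
    = Cmp D (omap F X) Y Z g (transpose X Y f)"
  unfolding transpose_def using assms counit.naturality[of Y Z g]
  by (simp add: hom_in F.amap_Cmp F.D.Cmp_assoc)

lemma transpose_amap:
  assumes "Y \<in> Obj D" "Z \<in> Obj D" "g \<in> Hom D Y Z"
  shows "transpose (omap G Y) Z (amap G Y Z g)
    = Cmp D (omap F (omap G Y)) Y Z g (\<epsilon> Y)"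
  unfolding transpose_def using assms counit.naturality[of Y Z g] by simp

text \<open>Naturality of \<eta> moves f to the innermost place, and the triangle law for G then
  cancels G \<epsilon> against \<eta>.\<close>

lemma amap_transpose_unit:
  assumes "X \<in> Obj C" "Y \<in> Obj D" "f \<in> Hom C X (omap G Y)"
  shows "Cmp C X (omap G (omap F X)) (omap G Y) (amap G (omap F X) Y (transpose X Y f)) (\<eta> X) = f"
proof -
  let ?GF = "\<lambda>X. omap G (omap F X)"
  let ?GFf = "amap G (omap F X) (omap F (omap G Y)) (amap F X (omap G Y) f)"
  let ?G\<epsilon> = "amap G (omap F (omap G Y)) Y (\<epsilon> Y)"
  have "Cmp C X (?GF X) (omap G Y) (amap G (omap F X) Y (transpose X Y f)) (\<eta> X)
    = Cmp C X (?GF (omap G Y)) (omap G Y) ?G\<epsilon> (Cmp C X (?GF X) (?GF (omap G Y)) ?GFf (\<eta> X))"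
    unfolding transpose_def using assms by (simp add: hom_in G.amap_Cmp F.C.Cmp_assoc)
  also have "\<dots> = Cmp C X (?GF (omap G Y)) (omap G Y) ?G\<epsilon>
      (Cmp C X (omap G Y) (?GF (omap G Y)) (\<eta> (omap G Y)) f)"
    using assms unit.naturality[of X "omap G Y" f] by (simp add: hom_in)
  also have "\<dots> = f"
    using assms triangle_right[of Y] by (simp add: hom_in F.C.Cmp_assoc F.C.Cmp_Ident_left)
  finally show ?thesis .
qed

end


section \<open>Categories of coalgebras\<close>

lemma in_Obj_coalg: "X \<in> Obj (coalg C S) \<longleftrightarrow> fst X \<in> Obj C \<and> snd X \<in> Hom C (fst X) (omap S (fst X))"
  by (auto simp: coalg_def)

lemma in_Hom_coalg:
  "f \<in> Hom (coalg C S) X Y \<longleftrightarrow> f \<in> Hom C (fst X) (fst Y) \<and>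
     Cmp C (fst X) (fst Y) (omap S (fst Y)) (snd Y) f
       = Cmp C (fst X) (omap S (fst X)) (omap S (fst Y)) (amap S (fst X) (fst Y) f) (snd X)"
  by (auto simp: coalg_def split: prod.splits)

lemma Ident_coalg: "Ident (coalg C S) X = Ident C (fst X)"
  by (auto simp: coalg_def split: prod.splits)

lemma Cmp_coalg: "Cmp (coalg C S) X Y Z = Cmp C (fst X) (fst Y) (fst Z)"
  by (auto simp: coalg_def split: prod.splits)

lemmas coalg_simps = in_Obj_coalg in_Hom_coalg Ident_coalg Cmp_coalg

text \<open>Only closure under composition has content: the coalgebra squares of f and g are pasted.
  The unit and associativity laws come from C.\<close>

lemma category_coalg:
  assumes "cat_functor C C S"
  shows "category (coalg C S)"
proof -
  interpret cat_functor C C S by fact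
  show ?thesis
  proof
    fix X Y Z f g
    assume "X \<in> Obj (coalg C S)" "Y \<in> Obj (coalg C S)" "Z \<in> Obj (coalg C S)"
      "f \<in> Hom (coalg C S) X Y" "g \<in> Hom (coalg C S) Y Z"
    moreover obtain X0 c Y0 d Z0 e where "X = (X0, c)" "Y = (Y0, d)" "Z = (Z0, e)"
      by (metis surj_pair)
    ultimately have
      XYZ: "X0 \<in> Obj C" "Y0 \<in> Obj C" "Z0 \<in> Obj C"
      and cde: "c \<in> Hom C X0 (omap S X0)" "d \<in> Hom C Y0 (omap S Y0)" "e \<in> Hom C Z0 (omap S Z0)"
      and f: "f \<in> Hom C X0 Y0" "Cmp C X0 Y0 (omap S Y0) d f
        = Cmp C X0 (omap S X0) (omap S Y0) (amap S X0 Y0 f) c"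
      and g: "g \<in> Hom C Y0 Z0" "Cmp C Y0 Z0 (omap S Z0) e g
        = Cmp C Y0 (omap S Y0) (omap S Z0) (amap S Y0 Z0 g) d"
      and [simp]: "X = (X0, c)" "Y = (Y0, d)" "Z = (Z0, e)"
      by (simp_all add: coalg_simps)
    have "Cmp C X0 Z0 (omap S Z0) e (Cmp C X0 Y0 Z0 g f)
      = Cmp C X0 Y0 (omap S Z0) (Cmp C Y0 (omap S Y0) (omap S Z0) (amap S Y0 Z0 g) d) f"
      using XYZ cde f(1) g by (simp add: C.Cmp_assoc omap_in amap_in)
    \<comment> \<open>The square of f is used from right to left: S f after c becomes d after f, so
      both sides become S g after d after f.\<close>
    also have "\<dots> = Cmp C X0 (omap S Y0) (omap S Z0) (amap S Y0 Z0 g)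
        (Cmp C X0 (omap S X0) (omap S Y0) (amap S X0 Y0 f) c)"
      using XYZ cde f(1) g(1) by (simp add: C.Cmp_assoc omap_in amap_in flip: f(2))
    also have "\<dots> = Cmp C X0 (omap S X0) (omap S Z0) (amap S X0 Z0 (Cmp C X0 Y0 Z0 g f)) c"
      using XYZ cde f(1) g(1) by (simp add: C.Cmp_assoc amap_Cmp omap_in amap_in)
    finally show "Cmp (coalg C S) X Y Z g f \<in> Hom (coalg C S) X Z"
      using XYZ f g by (simp add: coalg_simps C.Cmp_in)
  qed (simp_all add: coalg_simps C.Ident_in C.Cmp_Ident_left C.Cmp_Ident_right C.Cmp_assoc
      amap_Ident omap_in)
qed

lemma cat_functor_forget:
  assumes "cat_functor C C S"
  shows "cat_functor (coalg C S) C forget_fctr"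
proof -
  interpret cat_functor C C S by fact
  interpret coalg: category "coalg C S" using assms by (rule category_coalg)
  show ?thesis by unfold_locales (simp_all add: coalg_simps)
qed

section \<open>Composition of functors and inversion of natural isomorphisms\<close>

lemma cat_functor_id: "category C \<Longrightarrow> cat_functor C C id_fctr"
  by (simp add: cat_functor_def cat_functor_axioms_def)

lemma cat_functor_comp:
  assumes "cat_functor C D F" "cat_functor D E G"
  shows "cat_functor C E (comp_fctr G F)"
proof -
  interpret F: cat_functor C D F by fact
  interpret G: cat_functor D E G by fact
  show ?thesis
    by unfold_locales (simp_all add: F.omap_in F.amap_in F.amap_Ident F.amap_Cmp
        G.omap_in G.amap_in G.amap_Ident G.amap_Cmp)
qed

text \<open>Componentwise inverses are natural: inserting \<alpha> after \<beta> next to G f lets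
  naturality of \<alpha> exchange G f for F f, and \<beta> after \<alpha> then cancels.\<close>

lemma nat_iso_inverse:
  assumes "nat_iso C D F G \<alpha>"
  obtains \<beta> where "nat_iso C D G F \<beta>"
    and "\<And>X. X \<in> Obj C \<Longrightarrow> Cmp D (omap F X) (omap G X) (omap F X) (\<beta> X) (\<alpha> X) = Ident D (omap F X)"
    and "\<And>X. X \<in> Obj C \<Longrightarrow> Cmp D (omap G X) (omap F X) (omap G X) (\<alpha> X) (\<beta> X) = Ident D (omap G X)"
proof -
  interpret nat_iso C D F G \<alpha> by fact
  obtain \<beta> where \<beta>: "\<beta> X \<in> Hom D (omap G X) (omap F X)"
    "Cmp D (omap F X) (omap G X) (omap F X) (\<beta> X) (\<alpha> X) = Ident D (omap F X)"
    "Cmp D (omap G X) (omap F X) (omap G X) (\<alpha> X) (\<beta> X) = Ident D (omap G X)" if "X \<in> Obj C" for X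
    using component_iso unfolding iso_in_def by metis
  have "nat_iso C D G F \<beta>"
  proof
    fix X Y f assume XY: "X \<in> Obj C" "Y \<in> Obj C" and f: "f \<in> Hom C X Y"
    note [simp] = XY f \<beta>(1) component_in F.omap_in F.amap_in G.omap_in G.amap_in F.D.Cmp_in
    have "Cmp D (omap G X) (omap G Y) (omap F Y) (\<beta> Y) (amap G X Y f)
      = Cmp D (omap G X) (omap G Y) (omap F Y) (\<beta> Y)
          (Cmp D (omap G X) (omap G X) (omap G Y) (amap G X Y f)
            (Cmp D (omap G X) (omap F X) (omap G X) (\<alpha> X) (\<beta> X)))"
      by (simp add: \<beta>(3) F.D.Cmp_Ident_right)
    also have "\<dots> = Cmp D (omap G X) (omap G Y) (omap F Y) (\<beta> Y)
          (Cmp D (omap G X) (omap F X) (omap G Y)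
            (Cmp D (omap F X) (omap F Y) (omap G Y) (\<alpha> Y) (amap F X Y f)) (\<beta> X))"
      by (simp add: naturality F.D.Cmp_assoc)
    also have "\<dots> = Cmp D (omap G X) (omap F X) (omap F Y)
          (Cmp D (omap F X) (omap F Y) (omap F Y)
            (Cmp D (omap F Y) (omap G Y) (omap F Y) (\<beta> Y) (\<alpha> Y)) (amap F X Y f)) (\<beta> X)"
      by (simp add: F.D.Cmp_assoc del: \<beta>(2))
    also have "\<dots> = Cmp D (omap G X) (omap F X) (omap F Y) (amap F X Y f) (\<beta> X)"
      by (simp add: \<beta>(2) F.D.Cmp_Ident_left)
    finally show "Cmp D (omap G X) (omap G Y) (omap F Y) (\<beta> Y) (amap G X Y f)
      = Cmp D (omap G X) (omap F X) (omap F Y) (amap F X Y f) (\<beta> X)" .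
  next
    fix X assume "X \<in> Obj C"
    then show "iso_in D (omap G X) (omap F X) (\<beta> X)"
      unfolding iso_in_def
      by (intro conjI bexI[of _ "\<alpha> X"]) (simp_all add: \<beta> component_in)
  qed (simp add: \<beta>)
  then show thesis using \<beta>(2,3) by (rule that)
qed


section \<open>Lifting an adjunction to coalgebras\<close>

text \<open>Both directions of the isomorphism between S G and G R are parameters: \<gamma> builds
  coalgebras on F X, \<open>\<gamma>'\<close> builds coalgebras on G Y. The law
  \<open>bwd_fwd\<close> makes the unit a coalgebra morphism, \<open>fwd_bwd\<close> the
  counit.\<close>

locale adjunction_intertwining = adjunction C D F G \<eta> \<epsilon> +
  S: cat_functor C C S + R: cat_functor D D R +
  fwd: nat_trans D C "comp_fctr S G" "comp_fctr G R" \<gamma> +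
  bwd: nat_trans D C "comp_fctr G R" "comp_fctr S G" \<gamma>'
  for C :: "('o, 'm, 'x) cat_scheme" and D :: "('p, 'n, 'y) cat_scheme"
    and F G \<eta> \<epsilon> S R \<gamma> \<gamma>' +
  assumes bwd_fwd: "Y \<in> Obj D \<Longrightarrow>
      Cmp C (omap S (omap G Y)) (omap G (omap R Y)) (omap S (omap G Y)) (\<gamma>' Y) (\<gamma> Y)
        = Ident C (omap S (omap G Y))"
    and fwd_bwd: "Y \<in> Obj D \<Longrightarrow>
      Cmp C (omap G (omap R Y)) (omap S (omap G Y)) (omap G (omap R Y)) (\<gamma> Y) (\<gamma>' Y)
        = Ident C (omap G (omap R Y))"
begin

definition right_struct :: "'p \<Rightarrow> 'n \<Rightarrow> 'm" where
  "right_struct Y d = Cmp C (omap G Y) (omap G (omap R Y)) (omap S (omap G Y))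
     (\<gamma>' Y) (amap G Y (omap R Y) d)"

text \<open>The structure on F X before transposition. Keeping it in C lets equations about the
  lifted coalgebra be checked there and carried to D by naturality of
  \<open>transpose\<close>.\<close>

definition left_struct_transposed :: "'o \<Rightarrow> 'm \<Rightarrow> 'm" where
  "left_struct_transposed X c =
     Cmp C X (omap S (omap G (omap F X))) (omap G (omap R (omap F X))) (\<gamma> (omap F X))
       (Cmp C X (omap S X) (omap S (omap G (omap F X))) (amap S X (omap G (omap F X)) (\<eta> X)) c)"

definition left_lift :: "('o \<times> 'm, 'm, 'p \<times> 'n, 'n) fctr" where
  "left_lift = \<lparr>omap = (\<lambda>(X, c). (omap F X,
       transpose X (omap R (omap F X)) (left_struct_transposed X c))),
     amap = (\<lambda>X Y. amap F (fst X) (fst Y))\<rparr>"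

definition right_lift :: "('p \<times> 'n, 'n, 'o \<times> 'm, 'm) fctr" where
  "right_lift = \<lparr>omap = (\<lambda>(Y, d). (omap G Y, right_struct Y d)),
     amap = (\<lambda>X Y. amap G (fst X) (fst Y))\<rparr>"

lemma fst_lift [simp]:
  "fst (omap left_lift X) = omap F (fst X)"
  "fst (omap right_lift Y) = omap G (fst Y)"
  by (simp_all add: left_lift_def right_lift_def split: prod.split)

text \<open>Kept out of the default simplifier set, so that structure maps stay folded until a
  coalgebra equation is at stake.\<close>

lemma snd_lift:
  "snd (omap left_lift X) = transpose (fst X) (omap R (omap F (fst X)))
     (left_struct_transposed (fst X) (snd X))"
  "snd (omap right_lift Y) = right_struct (fst Y) (snd Y)"
  by (simp_all add: left_lift_def right_lift_def split: prod.split)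

lemma amap_lift [simp]:
  "amap left_lift X X' = amap F (fst X) (fst X')"
  "amap right_lift Y Y' = amap G (fst Y) (fst Y')"
  by (simp_all add: left_lift_def right_lift_def)

lemma \<gamma>_in: "Y \<in> Obj D \<Longrightarrow> \<gamma> Y \<in> Hom C (omap S (omap G Y)) (omap G (omap R Y))"
  using fwd.component_in[of Y] by simp

lemma \<gamma>'_in: "Y \<in> Obj D \<Longrightarrow> \<gamma>' Y \<in> Hom C (omap G (omap R Y)) (omap S (omap G Y))"
  using bwd.component_in[of Y] by simp

lemmas intertwining_hom_in = hom_in S.omap_in S.amap_in R.omap_in R.amap_in \<gamma>_in \<gamma>'_in transpose_in

section \<open>The lifted functors on structure maps and morphisms\<close>

lemma right_struct_in:
  "\<lbrakk>Y \<in> Obj D; d \<in> Hom D Y (omap R Y)\<rbrakk> \<Longrightarrow> right_struct Y d \<in> Hom C (omap G Y) (omap S (omap G Y))"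
  by (simp add: right_struct_def intertwining_hom_in)

lemma left_struct_transposed_in:
  "\<lbrakk>X \<in> Obj C; c \<in> Hom C X (omap S X)\<rbrakk>
    \<Longrightarrow> left_struct_transposed X c \<in> Hom C X (omap G (omap R (omap F X)))"
  by (simp add: left_struct_transposed_def intertwining_hom_in)

text \<open>This is the coalgebra square of F f, seen on the C side of the adjunction. Three squares
  are pasted: the coalgebra square of f, S applied to naturality of \<eta>, and naturality of
  \<gamma> at F f.\<close>

lemma left_struct_transposed_natural:
  assumes XY: "X \<in> Obj C" "Y \<in> Obj C"
    and cd: "c \<in> Hom C X (omap S X)" "d \<in> Hom C Y (omap S Y)"
    and f: "f \<in> Hom C X Y"
    and hom: "Cmp C X Y (omap S Y) d f = Cmp C X (omap S X) (omap S Y) (amap S X Y f) c"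
  shows "Cmp C X Y (omap G (omap R (omap F Y))) (left_struct_transposed Y d) f
    = Cmp C X (omap G (omap R (omap F X))) (omap G (omap R (omap F Y)))
        (amap G (omap R (omap F X)) (omap R (omap F Y))
          (amap R (omap F X) (omap F Y) (amap F X Y f))) (left_struct_transposed X c)"
proof -
  let ?GF = "\<lambda>X. omap G (omap F X)"
  let ?GRF = "\<lambda>X. omap G (omap R (omap F X))"
  let ?GFf = "amap G (omap F X) (omap F Y) (amap F X Y f)"
  note [simp] = XY cd f intertwining_hom_in
  have S\<eta>: "Cmp C (omap S X) (omap S Y) (omap S (?GF Y)) (amap S Y (?GF Y) (\<eta> Y)) (amap S X Y f)
    = Cmp C (omap S X) (omap S (?GF X)) (omap S (?GF Y))
        (amap S (?GF X) (?GF Y) ?GFf) (amap S X (?GF X) (\<eta> X))"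
    using unit.naturality[of X Y f] by (simp flip: S.amap_Cmp)
  have "Cmp C X Y (?GRF Y) (left_struct_transposed Y d) f
    = Cmp C X (omap S (?GF Y)) (?GRF Y) (\<gamma> (omap F Y))
        (Cmp C X (omap S Y) (omap S (?GF Y)) (amap S Y (?GF Y) (\<eta> Y)) (Cmp C X Y (omap S Y) d f))"
    by (simp add: left_struct_transposed_def F.C.Cmp_assoc)
  also have "\<dots> = Cmp C X (omap S (?GF Y)) (?GRF Y) (\<gamma> (omap F Y))
        (Cmp C X (omap S X) (omap S (?GF Y)) (Cmp C (omap S X) (omap S (?GF X)) (omap S (?GF Y))
          (amap S (?GF X) (?GF Y) ?GFf) (amap S X (?GF X) (\<eta> X))) c)"
    by (simp add: hom F.C.Cmp_assoc S\<eta>)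
  also have "\<dots> = Cmp C X (omap S (?GF X)) (?GRF Y)
        (Cmp C (omap S (?GF X)) (omap S (?GF Y)) (?GRF Y) (\<gamma> (omap F Y)) (amap S (?GF X) (?GF Y) ?GFf))
        (Cmp C X (omap S X) (omap S (?GF X)) (amap S X (?GF X) (\<eta> X)) c)"
    by (simp add: F.C.Cmp_assoc)
  also have "\<dots> = Cmp C X (?GRF X) (?GRF Y)
        (amap G (omap R (omap F X)) (omap R (omap F Y))
          (amap R (omap F X) (omap F Y) (amap F X Y f))) (left_struct_transposed X c)"
    using fwd.naturality[of "omap F X" "omap F Y" "amap F X Y f"]
    by (simp add: left_struct_transposed_def F.C.Cmp_assoc)
  finally show ?thesis .
qed

lemma left_lift_functor: "cat_functor (coalg C S) (coalg D R) left_lift"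
proof -
  interpret CS: category "coalg C S" by (rule category_coalg) unfold_locales
  interpret DR: category "coalg D R" by (rule category_coalg) unfold_locales
  show ?thesis
  proof
    fix X Y f
    assume "X \<in> Obj (coalg C S)" "Y \<in> Obj (coalg C S)" "f \<in> Hom (coalg C S) X Y"
    \<comment> \<open>Both sides of the required equation in D are transposes of the two sides of
      the naturality equation in C.\<close>
    then show "amap left_lift X Y f \<in> Hom (coalg D R) (omap left_lift X) (omap left_lift Y)"
      using left_struct_transposed_natural[of "fst X" "fst Y" "snd X" "snd Y" f]
      by (simp add: coalg_simps snd_lift intertwining_hom_in left_struct_transposed_in
          flip: transpose_Cmp_left transpose_Cmp_right)
  qed (simp_all add: coalg_simps snd_lift intertwining_hom_in left_struct_transposed_in
      F.amap_Ident F.amap_Cmp)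
qed

text \<open>G preserves the coalgebra square of f, and naturality of \<open>\<gamma>'\<close> at f
  moves the result from G R to S G.\<close>

lemma right_lift_functor: "cat_functor (coalg D R) (coalg C S) right_lift"
proof -
  interpret CS: category "coalg C S" by (rule category_coalg) unfold_locales
  interpret DR: category "coalg D R" by (rule category_coalg) unfold_locales
  show ?thesis
  proof
    fix X Y f
    assume "X \<in> Obj (coalg D R)" "Y \<in> Obj (coalg D R)" "f \<in> Hom (coalg D R) X Y"
    moreover obtain X0 c Y0 d where "X = (X0, c)" "Y = (Y0, d)"
      by (metis surj_pair)
    ultimately have [simp]: "X0 \<in> Obj D" "Y0 \<in> Obj D"
      "c \<in> Hom D X0 (omap R X0)" "d \<in> Hom D Y0 (omap R Y0)" "f \<in> Hom D X0 Y0"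
      and hom: "Cmp D X0 Y0 (omap R Y0) d f = Cmp D X0 (omap R X0) (omap R Y0) (amap R X0 Y0 f) c"
      and [simp]: "X = (X0, c)" "Y = (Y0, d)"
      by (simp_all add: coalg_simps)
    note [simp] = intertwining_hom_in
    have "Cmp C (omap G X0) (omap G Y0) (omap S (omap G Y0)) (right_struct Y0 d) (amap G X0 Y0 f)
      = Cmp C (omap G X0) (omap G (omap R Y0)) (omap S (omap G Y0)) (\<gamma>' Y0)
          (amap G X0 (omap R Y0) (Cmp D X0 Y0 (omap R Y0) d f))"
      by (simp add: right_struct_def G.amap_Cmp F.C.Cmp_assoc)
    also have "\<dots> = Cmp C (omap G X0) (omap S (omap G X0)) (omap S (omap G Y0))
          (amap S (omap G X0) (omap G Y0) (amap G X0 Y0 f)) (right_struct X0 c)"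
      using bwd.naturality[of X0 Y0 f]
      by (simp add: right_struct_def hom G.amap_Cmp F.C.Cmp_assoc)
    finally show "amap right_lift X Y f \<in> Hom (coalg C S) (omap right_lift X) (omap right_lift Y)"
      by (simp add: coalg_simps snd_lift)
  qed (simp_all add: coalg_simps snd_lift intertwining_hom_in right_struct_in G.amap_Ident G.amap_Cmp)
qed

text \<open>Composing with \<eta> undoes the transposition in the structure on F X and leaves
  \<open>\<gamma>'\<close> after \<gamma> after S \<eta> after c. The isomorphism cancels, which
  gives the other side of the square.\<close>

lemma unit_coalg_hom:
  assumes "X \<in> Obj C" "c \<in> Hom C X (omap S X)"
  shows "\<eta> X \<in> Hom (coalg C S) (X, c) (omap right_lift (omap left_lift (X, c)))"
proof -
  let ?FX = "omap F X"
  let ?k = "left_struct_transposed X c"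
  note [simp] = assms intertwining_hom_in left_struct_transposed_in
  have "Cmp C X (omap G ?FX) (omap S (omap G ?FX))
      (right_struct ?FX (transpose X (omap R ?FX) ?k)) (\<eta> X)
    = Cmp C X (omap G (omap R ?FX)) (omap S (omap G ?FX)) (\<gamma>' ?FX)
        (Cmp C X (omap G ?FX) (omap G (omap R ?FX))
          (amap G ?FX (omap R ?FX) (transpose X (omap R ?FX) ?k)) (\<eta> X))"
    by (simp add: right_struct_def F.C.Cmp_assoc)
  also have "\<dots> = Cmp C X (omap G (omap R ?FX)) (omap S (omap G ?FX)) (\<gamma>' ?FX) ?k"
    by (simp add: amap_transpose_unit)
  also have "\<dots> = Cmp C X (omap S X) (omap S (omap G ?FX)) (amap S X (omap G ?FX) (\<eta> X)) c"
    by (simp add: left_struct_transposed_def F.C.Cmp_assoc bwd_fwd F.C.Cmp_Ident_left)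
  finally show ?thesis by (simp add: coalg_simps snd_lift)
qed

text \<open>The equation in D is the transpose of one in C, between G R \<epsilon> after the
  untransposed structure and G d. There \<gamma> meets \<open>\<gamma>'\<close> once the triangle
  law has removed what lies between them.\<close>

lemma counit_coalg_hom:
  assumes "Y \<in> Obj D" "d \<in> Hom D Y (omap R Y)"
  shows "\<epsilon> Y \<in> Hom (coalg D R) (omap left_lift (omap right_lift (Y, d))) (Y, d)"
proof -
  let ?GY = "omap G Y" and ?FGY = "omap F (omap G Y)" and ?GFGY = "omap G (omap F (omap G Y))"
  let ?k = "left_struct_transposed ?GY (right_struct Y d)"
  let ?GR\<epsilon> = "amap G (omap R ?FGY) (omap R Y) (amap R ?FGY Y (\<epsilon> Y))"
  let ?SG\<epsilon> = "amap S ?GFGY ?GY (amap G ?FGY Y (\<epsilon> Y))"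
  note [simp] = assms intertwining_hom_in right_struct_in left_struct_transposed_in
  \<comment> \<open>S applied to the triangle law for G.\<close>
  have tri: "Cmp C (omap S ?GY) (omap S ?GFGY) (omap S ?GY) ?SG\<epsilon> (amap S ?GY ?GFGY (\<eta> ?GY))
    = Ident C (omap S ?GY)"
    by (simp add: triangle_right S.amap_Ident flip: S.amap_Cmp)
  \<comment> \<open>Naturality of \<gamma> at \<epsilon> turns G R \<epsilon> into S G \<epsilon>,
    to which \<open>tri\<close> applies.\<close>
  have nat: "Cmp C (omap S ?GFGY) (omap G (omap R ?FGY)) (omap G (omap R Y)) ?GR\<epsilon> (\<gamma> ?FGY)
    = Cmp C (omap S ?GFGY) (omap S ?GY) (omap G (omap R Y)) (\<gamma> Y) ?SG\<epsilon>"
    using fwd.naturality[of ?FGY Y "\<epsilon> Y"] by simp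
  have "Cmp C ?GY (omap G (omap R ?FGY)) (omap G (omap R Y)) ?GR\<epsilon> ?k
    = Cmp C ?GY (omap S ?GFGY) (omap G (omap R Y))
        (Cmp C (omap S ?GFGY) (omap G (omap R ?FGY)) (omap G (omap R Y)) ?GR\<epsilon> (\<gamma> ?FGY))
        (Cmp C ?GY (omap S ?GY) (omap S ?GFGY) (amap S ?GY ?GFGY (\<eta> ?GY)) (right_struct Y d))"
    by (simp add: left_struct_transposed_def F.C.Cmp_assoc)
  also have "\<dots> = Cmp C ?GY (omap S ?GY) (omap G (omap R Y)) (\<gamma> Y)
        (Cmp C ?GY (omap S ?GY) (omap S ?GY)
          (Cmp C (omap S ?GY) (omap S ?GFGY) (omap S ?GY) ?SG\<epsilon> (amap S ?GY ?GFGY (\<eta> ?GY)))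
          (right_struct Y d))"
    by (simp add: nat F.C.Cmp_assoc)
  also have "\<dots> = Cmp C ?GY (omap S ?GY) (omap G (omap R Y)) (\<gamma> Y) (right_struct Y d)"
    by (simp add: tri F.C.Cmp_Ident_left)
  also have "\<dots> = amap G Y (omap R Y) d"
    by (simp add: right_struct_def F.C.Cmp_assoc fwd_bwd F.C.Cmp_Ident_left)
  \<comment> \<open>The left side transposes by naturality in the second argument, the right side by
    \<open>transpose_amap\<close>.\<close>
  finally have "Cmp D ?FGY (omap R ?FGY) (omap R Y) (amap R ?FGY Y (\<epsilon> Y)) (transpose ?GY (omap R ?FGY) ?k)
    = Cmp D ?FGY Y (omap R Y) d (\<epsilon> Y)"
    by (simp add: transpose_amap flip: transpose_Cmp_left)
  then show ?thesis by (simp add: coalg_simps snd_lift)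
qed

text \<open>Composites and identities of coalgebra morphisms are those of C and D, so naturality and
  the triangle laws are inherited, and commutation with \<open>forget_fctr\<close> holds by
  construction. What is new is that \<eta> and \<epsilon> lie in the coalgebra homs.\<close>

lemma adjunction_lift_coalg:
  "adjunction_lift C D F G \<eta> \<epsilon> (coalg C S) (coalg D R) left_lift right_lift
     (\<lambda>X. \<eta> (fst X)) (\<lambda>Y. \<epsilon> (fst Y)) forget_fctr forget_fctr"
proof -
  interpret L: cat_functor "coalg C S" "coalg D R" left_lift by (rule left_lift_functor)
  interpret L': cat_functor "coalg D R" "coalg C S" right_lift by (rule right_lift_functor)
  interpret P: cat_functor "coalg C S" C forget_fctr by (rule cat_functor_forget) unfold_locales
  interpret Q: cat_functor "coalg D R" D forget_fctr by (rule cat_functor_forget) unfold_locales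
  interpret IC: cat_functor "coalg C S" "coalg C S" id_fctr
    by (rule cat_functor_id) unfold_locales
  interpret ID: cat_functor "coalg D R" "coalg D R" id_fctr
    by (rule cat_functor_id) unfold_locales
  interpret GF: cat_functor "coalg C S" "coalg C S" "comp_fctr right_lift left_lift"
    by (rule cat_functor_comp) unfold_locales
  interpret FG: cat_functor "coalg D R" "coalg D R" "comp_fctr left_lift right_lift"
    by (rule cat_functor_comp) unfold_locales
  show ?thesis
  proof
    show "\<eta> (fst X) \<in> Hom (coalg C S) (omap id_fctr X) (omap (comp_fctr right_lift left_lift) X)"
      if "X \<in> Obj (coalg C S)" for X
      using that unit_coalg_hom[of "fst X" "snd X"] by (simp add: in_Obj_coalg)
    show "\<epsilon> (fst Y) \<in> Hom (coalg D R) (omap (comp_fctr left_lift right_lift) Y) (omap id_fctr Y)"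
      if "Y \<in> Obj (coalg D R)" for Y
      using that counit_coalg_hom[of "fst Y" "snd Y"] by (simp add: in_Obj_coalg)
  qed (use unit.naturality counit.naturality in \<open>simp_all add: coalg_simps F.amap_Ident F.amap_Cmp
      G.amap_Ident G.amap_Cmp intertwining_hom_in triangle_left triangle_right L.omap_in
      L'.omap_in fctr_eq_on_def snd_lift right_struct_in left_struct_transposed_in\<close>)
qed

end


text \<open>Builds the locale instance from a single isomorphism, as a lifting supplies it; the
  inverse comes from \<open>nat_iso_inverse\<close>.\<close>

lemma intertwining_of_nat_iso:
  assumes "adjunction C D F G \<eta> \<epsilon>" "cat_functor C C S" "cat_functor D D R"
    and \<gamma>: "nat_iso D C (comp_fctr S G) (comp_fctr G R) \<gamma>"
  obtains \<gamma>' where "adjunction_intertwining C D F G \<eta> \<epsilon> S R \<gamma> \<gamma>'"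
proof -
  obtain \<gamma>' where nat: "nat_iso D C (comp_fctr G R) (comp_fctr S G) \<gamma>'"
    and inv: "\<And>Y. Y \<in> Obj D \<Longrightarrow> Cmp C (omap (comp_fctr S G) Y) (omap (comp_fctr G R) Y)
        (omap (comp_fctr S G) Y) (\<gamma>' Y) (\<gamma> Y) = Ident C (omap (comp_fctr S G) Y)"
      "\<And>Y. Y \<in> Obj D \<Longrightarrow> Cmp C (omap (comp_fctr G R) Y) (omap (comp_fctr S G) Y)
        (omap (comp_fctr G R) Y) (\<gamma> Y) (\<gamma>' Y) = Ident C (omap (comp_fctr G R) Y)"
    by (rule nat_iso_inverse[OF \<gamma>]) (rule that)
  have "adjunction_intertwining C D F G \<eta> \<epsilon> S R \<gamma> \<gamma>'"
    by (intro adjunction_intertwining.intro adjunction_intertwining_axioms.intro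
        assms(1-3) nat_iso.axioms(1)[OF \<gamma>] nat_iso.axioms(1)[OF nat] inv[simplified])
  then show thesis by (rule that)
qed


section \<open>Enrichment in preorders\<close>

lemma preord_coalg_simps [simp]:
  "Obj (preord_coalg C S) = Obj (coalg C S)"
  "Hom (preord_coalg C S) = Hom (coalg C S)"
  "Ident (preord_coalg C S) = Ident (coalg C S)"
  "Cmp (preord_coalg C S) = Cmp (coalg C S)"
  "HomOrd (preord_coalg C S) X Y
    = HomOrd C (fst X) (fst Y) \<inter> (Hom (coalg C S) X Y \<times> Hom (coalg C S) X Y)"
  by (simp_all add: preord_coalg_def cat.defs pcat.defs)

lemma underlying_pcat_simps [simp]:
  "Obj (underlying_pcat C) = Obj C"
  "Hom (underlying_pcat C) = Hom C"
  "Ident (underlying_pcat C) = Ident C"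
  "Cmp (underlying_pcat C) = Cmp C"
  "HomOrd (underlying_pcat C) X Y = underlying_order (Hom C X Y) (HomV C X Y)"
  by (simp_all add: underlying_pcat_def cat.defs pcat.defs)

lemma category_preord_coalg [simp]: "category (preord_coalg C S) \<longleftrightarrow> category (coalg C S)"
  by (simp add: category_def)

text \<open>An ordinary adjunction sees only objects, homs, identities and composition, on which the
  two records agree. Their types differ, so the locale predicates are unfolded down to these
  fields.\<close>

lemma adjunction_lift_preord_coalg:
  "adjunction_lift C D F G \<eta> \<epsilon> (preord_coalg C S) (preord_coalg D R) F' G' \<eta>' \<epsilon>' P Q
    \<longleftrightarrow> adjunction_lift C D F G \<eta> \<epsilon> (coalg C S) (coalg D R) F' G' \<eta>' \<epsilon>' P Q"
  unfolding adjunction_lift_def adjunction_lift_axioms_def adjunction_def adjunction_axioms_def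
    nat_trans_def nat_trans_axioms_def cat_functor_def cat_functor_axioms_def fctr_eq_on_def
  by simp

lemma vcat_coalg_simps [simp]:
  "Obj (vcat_coalg C S) = Obj (coalg C S)"
  "Hom (vcat_coalg C S) = Hom (coalg C S)"
  "Ident (vcat_coalg C S) = Ident (coalg C S)"
  "Cmp (vcat_coalg C S) = Cmp (coalg C S)"
  "HomV (vcat_coalg C S) X Y = HomV C (fst X) (fst Y)"
  by (simp_all add: vcat_coalg_def cat.defs vcat.defs)

lemma coalg_underlying_pcat [simp]: "coalg (underlying_pcat C) S = coalg C S"
  by (simp add: coalg_def)

text \<open>Hom-values are inherited from the base, so forming coalgebras commutes with passing to
  underlying orders. Coalgebras over \<open>v_cat\<close> thereby become coalgebras in a
  preorder-enriched category.\<close>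

lemma underlying_pcat_vcat_coalg:
  "underlying_pcat (vcat_coalg C S) = preord_coalg (underlying_pcat C) S"
  by (rule pcat.equality) (auto simp: fun_eq_iff underlying_order_def in_Hom_coalg)

lemma preord_category_coalg:
  assumes "preord_functor C C S"
  shows "preord_category (preord_coalg C S)"
proof -
  interpret preord_functor C C S by fact
  interpret coalg: category "coalg C S" by (rule category_coalg) unfold_locales
  interpret pcoalg: category "preord_coalg C S" by simp unfold_locales
  show ?thesis
  proof
    fix X Y assume "X \<in> Obj (preord_coalg C S)" "Y \<in> Obj (preord_coalg C S)"
    then have "preorder_on (Hom C (fst X) (fst Y)) (HomOrd C (fst X) (fst Y))"
      by (simp add: C.HomOrd_preorder in_Obj_coalg)
    then show "preorder_on (Hom (preord_coalg C S) X Y) (HomOrd (preord_coalg C S) X Y)"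
      by (auto simp: preorder_on_def refl_on_def in_Hom_coalg intro!: transI elim: transE)
  next
    fix X Y Z f f' g g'
    assume "X \<in> Obj (preord_coalg C S)" "Y \<in> Obj (preord_coalg C S)" "Z \<in> Obj (preord_coalg C S)"
      "(f, f') \<in> HomOrd (preord_coalg C S) X Y" "(g, g') \<in> HomOrd (preord_coalg C S) Y Z"
    then show "(Cmp (preord_coalg C S) X Y Z g f, Cmp (preord_coalg C S) X Y Z g' f')
        \<in> HomOrd (preord_coalg C S) X Z"
      using coalg.Cmp_in[of X Y Z f g] coalg.Cmp_in[of X Y Z f' g']
        C.Cmp_mono[of "fst X" "fst Y" "fst Z" f f' g g']
      by (simp add: Cmp_coalg in_Obj_coalg)
  qed
qed

section \<open>From quantale enrichment to preorder enrichment\<close>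

lemma one_le_mult:
  fixes a b :: "'v::comm_quantale"
  shows "\<lbrakk>1 \<le> a; 1 \<le> b\<rbrakk> \<Longrightarrow> 1 \<le> a * b"
  using mult_mono_quantale[of 1 a 1 b] by simp

lemma preorder_on_underlying_order:
  assumes "v_category A h"
  shows "preorder_on A (underlying_order A h)"
  using assms
  by (auto simp: v_category_def preorder_on_def refl_on_def underlying_order_def intro!: transI)
    (meson one_le_mult order_trans)

text \<open>Composition is monotone by \<open>Cmp_enriched\<close>: two hom-values above 1 have a
  product above 1, and this product lies below the hom-value of the composites.\<close>

lemma preord_category_underlying:
  assumes "vcat_category C"
  shows "preord_category (underlying_pcat C)"
proof -
  interpret vcat_category C by fact
  have "category (underlying_pcat C)"
    using category_axioms by (simp add: category_def)
  then interpret U: category "underlying_pcat C" .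
  show ?thesis
  proof
    fix X Y assume "X \<in> Obj (underlying_pcat C)" "Y \<in> Obj (underlying_pcat C)"
    then show "preorder_on (Hom (underlying_pcat C) X Y) (HomOrd (underlying_pcat C) X Y)"
      by (simp add: HomV_category preorder_on_underlying_order)
  next
    fix X Y Z f f' g g'
    assume "X \<in> Obj (underlying_pcat C)" "Y \<in> Obj (underlying_pcat C)"
      "Z \<in> Obj (underlying_pcat C)"
      "(f, f') \<in> HomOrd (underlying_pcat C) X Y" "(g, g') \<in> HomOrd (underlying_pcat C) Y Z"
    then show "(Cmp (underlying_pcat C) X Y Z g f, Cmp (underlying_pcat C) X Y Z g' f')
        \<in> HomOrd (underlying_pcat C) X Z"
      using Cmp_enriched[of X Y Z f f' g g'] one_le_mult[of "HomV C Y Z g g'" "HomV C X Y f f'"]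
      by (auto simp: underlying_order_def Cmp_in intro: order_trans)
  qed
qed

lemma preord_functor_underlying:
  assumes "vcat_functor C D F"
  shows "preord_functor (underlying_pcat C) (underlying_pcat D) F"
proof -
  interpret vcat_functor C D F by fact
  interpret UC: preord_category "underlying_pcat C"
    by (rule preord_category_underlying) unfold_locales
  interpret UD: preord_category "underlying_pcat D"
    by (rule preord_category_underlying) unfold_locales
  show ?thesis
  proof
    fix X Y f g
    assume "X \<in> Obj (underlying_pcat C)" "Y \<in> Obj (underlying_pcat C)"
      "(f, g) \<in> HomOrd (underlying_pcat C) X Y"
    then show "(amap F X Y f, amap F X Y g) \<in> HomOrd (underlying_pcat D) (omap F X) (omap F Y)"
      using amap_enriched[of X Y]
      by (auto simp: underlying_order_def v_functor_def amap_in intro: order_trans)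
  qed (simp_all add: omap_in amap_in amap_Ident amap_Cmp)
qed

text \<open>Adds local monotonicity to the ordinary lift. The lifted functors act on morphisms as F
  and G; the restricted order also asks that the images be coalgebra morphisms, which functoriality
  provides.\<close>

lemma preord_adjunction_lift_coalg:
  assumes "preord_adjunction C D F G \<eta> \<epsilon>" "preord_functor C C S" "preord_functor D D R"
    and "adjunction_intertwining C D F G \<eta> \<epsilon> S R \<gamma> \<gamma>'"
  shows "\<exists>F' G' \<eta>' \<epsilon>'. preord_adjunction_lift C D F G \<eta> \<epsilon> (preord_coalg C S) (preord_coalg D R)
    F' G' \<eta>' \<epsilon>' forget_fctr forget_fctr"
proof -
  interpret adj: preord_adjunction C D F G \<eta> \<epsilon> by fact
  interpret S: preord_functor C C S by fact
  interpret R: preord_functor D D R by fact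
  interpret adjunction_intertwining C D F G \<eta> \<epsilon> S R \<gamma> \<gamma>' by fact
  interpret lift: adjunction_lift C D F G \<eta> \<epsilon> "preord_coalg C S" "preord_coalg D R"
    left_lift right_lift "\<lambda>X. \<eta> (fst X)" "\<lambda>Y. \<epsilon> (fst Y)" forget_fctr forget_fctr
    using adjunction_lift_coalg by (simp only: adjunction_lift_preord_coalg)
  interpret CS: preord_category "preord_coalg C S" by (rule preord_category_coalg) fact
  interpret DR: preord_category "preord_coalg D R" by (rule preord_category_coalg) fact
  have "preord_adjunction_lift C D F G \<eta> \<epsilon> (preord_coalg C S) (preord_coalg D R)
    left_lift right_lift (\<lambda>X. \<eta> (fst X)) (\<lambda>Y. \<epsilon> (fst Y)) forget_fctr forget_fctr"
  proof
    fix X Y f g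
    assume *: "X \<in> Obj (preord_coalg C S)" "Y \<in> Obj (preord_coalg C S)"
      "(f, g) \<in> HomOrd (preord_coalg C S) X Y"
    then show "(amap left_lift X Y f, amap left_lift X Y g)
        \<in> HomOrd (preord_coalg D R) (omap left_lift X) (omap left_lift Y)"
      using lift.lifted.F.amap_in[of X Y f] lift.lifted.F.amap_in[of X Y g]
        adj.F.amap_mono[of "fst X" "fst Y" f g]
      by (simp add: in_Obj_coalg)
  next
    fix X Y f g
    assume *: "X \<in> Obj (preord_coalg D R)" "Y \<in> Obj (preord_coalg D R)"
      "(f, g) \<in> HomOrd (preord_coalg D R) X Y"
    then show "(amap right_lift X Y f, amap right_lift X Y g)
        \<in> HomOrd (preord_coalg C S) (omap right_lift X) (omap right_lift Y)"
      using lift.lifted.G.amap_in[of X Y f] lift.lifted.G.amap_in[of X Y g]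
        adj.G.amap_mono[of "fst X" "fst Y" f g]
      by (simp add: in_Obj_coalg)
  qed simp_all
  then show ?thesis by blast
qed


section \<open>The adjunctions between sets, preorders and quantale-enriched categories\<close>

lemma category_set_cat: "category (set_cat U)"
  by unfold_locales
    (auto simp: set_cat_def compose_def PiE_iff restrict_def extensional_def fun_eq_iff)

lemma in_Obj_preord_cat: "(A, r) \<in> Obj (preord_cat U) \<longleftrightarrow> A \<in> U \<and> preorder_on A r"
  by (simp add: preord_cat_def)

lemma in_monotone_maps:
  "f \<in> monotone_maps (A, r) (B, s) \<longleftrightarrow> f \<in> A \<rightarrow>\<^sub>E B \<and> (\<forall>x' x. (x', x) \<in> r \<longrightarrow> (f x', f x) \<in> s)"
  by (auto simp: monotone_maps_def)

lemma in_HomOrd_preord_cat: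
  "(f, g) \<in> HomOrd (preord_cat U) (A, r) (B, s) \<longleftrightarrow>
     f \<in> monotone_maps (A, r) (B, s) \<and> g \<in> monotone_maps (A, r) (B, s) \<and> (\<forall>x\<in>A. (f x, g x) \<in> s)"
  by (simp add: preord_cat_def)

lemma preord_cat_simps:
  "Hom (preord_cat U) = monotone_maps"
  "Ident (preord_cat U) (A, r) = (\<lambda>x\<in>A. x)"
  "Cmp (preord_cat U) (A, r) Y Z g f = compose A g f"
  by (simp_all add: preord_cat_def)

lemma compose_monotone_maps:
  assumes "preorder_on A r" "f \<in> monotone_maps (A, r) (B, s)" "g \<in> monotone_maps (B, s) (C, t)"
  shows "compose A g f \<in> monotone_maps (A, r) (C, t)"
proof -
  \<comment> \<open>\<open>compose A g f\<close> takes a default value outside A, so monotonicity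
    along r needs r to relate only elements of A.\<close>
  have "x' \<in> A \<and> x \<in> A" if "(x', x) \<in> r" for x' x
    using assms(1) that by (auto simp: preorder_on_def)
  then show ?thesis
    using assms(2,3) by (simp add: in_monotone_maps compose_def PiE_iff)
qed

lemma preord_category_preord_cat: "preord_category (preord_cat U)"
proof
  fix X Y :: "'a preord"
  assume *: "Y \<in> Obj (preord_cat U)"
  obtain A r B s where XY: "X = (A, r)" "Y = (B, s)"
    by (metis surj_pair)
  have s: "trans s" "\<And>y. y \<in> B \<Longrightarrow> (y, y) \<in> s"
    using * by (simp_all add: XY in_Obj_preord_cat preorder_on_def refl_on_def)
  show "preorder_on (Hom (preord_cat U) X Y) (HomOrd (preord_cat U) X Y)"
    unfolding preorder_on_def
  proof (intro conjI)
    show "HomOrd (preord_cat U) X Y \<subseteq> Hom (preord_cat U) X Y \<times> Hom (preord_cat U) X Y"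
      by (auto simp: XY in_HomOrd_preord_cat preord_cat_simps)
    show "refl_on (Hom (preord_cat U) X Y) (HomOrd (preord_cat U) X Y)"
      by (auto simp: XY in_HomOrd_preord_cat preord_cat_simps refl_on_def in_monotone_maps
          PiE_iff intro: s(2))
    show "trans (HomOrd (preord_cat U) X Y)"
      by (rule transI) (simp add: XY in_HomOrd_preord_cat, meson transD[OF s(1)])
  qed
next
  fix X Y Z :: "'a preord" and f f' g g'
  obtain A r B s C t where XYZ: "X = (A, r)" "Y = (B, s)" "Z = (C, t)"
    by (metis surj_pair)
  assume X: "X \<in> Obj (preord_cat U)" and Z: "Z \<in> Obj (preord_cat U)"
    and ff': "(f, f') \<in> HomOrd (preord_cat U) X Y" and gg': "(g, g') \<in> HomOrd (preord_cat U) Y Z"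
  have "trans t"
    using Z by (simp add: XYZ in_Obj_preord_cat preorder_on_def)
  \<comment> \<open>One map is changed at a time: first f to f' under the monotone g, then g to g'
    at the point f' x.\<close>
  moreover have "(g (f x), g (f' x)) \<in> t" "(g (f' x), g' (f' x)) \<in> t" if "x \<in> A" for x
    using ff' gg' that by (auto simp: XYZ in_HomOrd_preord_cat in_monotone_maps)
  ultimately have "(g (f x), g' (f' x)) \<in> t" if "x \<in> A" for x
    using that by (meson transD)
  then show "(Cmp (preord_cat U) X Y Z g f, Cmp (preord_cat U) X Y Z g' f')
        \<in> HomOrd (preord_cat U) X Z"
    using X ff' gg' compose_monotone_maps[of A r f B s g C t]
      compose_monotone_maps[of A r f' B s g' C t]
    by (simp add: XYZ in_Obj_preord_cat in_HomOrd_preord_cat preord_cat_simps compose_eq)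
next
  fix X Y Z :: "'a preord" and f g
  assume "X \<in> Obj (preord_cat U)" "f \<in> Hom (preord_cat U) X Y" "g \<in> Hom (preord_cat U) Y Z"
  then show "Cmp (preord_cat U) X Y Z g f \<in> Hom (preord_cat U) X Z"
    by (cases X; cases Y; cases Z)
      (simp add: in_Obj_preord_cat preord_cat_simps compose_monotone_maps)
next
  fix X :: "'a preord"
  assume "X \<in> Obj (preord_cat U)"
  then show "Ident (preord_cat U) X \<in> Hom (preord_cat U) X X"
    by (cases X) (auto simp: in_Obj_preord_cat preord_cat_simps in_monotone_maps preorder_on_def)
next
  fix X Y :: "'a preord" and f
  assume "f \<in> Hom (preord_cat U) X Y"
  then have f: "f \<in> fst X \<rightarrow>\<^sub>E fst Y"
    by (cases X; cases Y) (simp add: preord_cat_simps in_monotone_maps)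
  then show "Cmp (preord_cat U) X X Y f (Ident (preord_cat U) X) = f"
    by (cases X) (auto simp: preord_cat_simps compose_def PiE_iff extensional_def fun_eq_iff)
  show "Cmp (preord_cat U) X Y Y (Ident (preord_cat U) Y) f = f"
    using f by (cases X; cases Y)
      (auto simp: preord_cat_simps compose_def PiE_iff extensional_def fun_eq_iff)
next
  fix W X Y Z :: "'a preord" and f g h
  assume "f \<in> Hom (preord_cat U) W X"
  then show "Cmp (preord_cat U) W Y Z h (Cmp (preord_cat U) W X Y g f)
      = Cmp (preord_cat U) W X Z (Cmp (preord_cat U) X Y Z h g) f"
    by (cases W; cases X; cases Y)
      (auto simp: preord_cat_simps in_monotone_maps compose_def PiE_iff fun_eq_iff)
qed

lemma cat_functor_Do: "cat_functor (set_cat U) (preord_cat U) Do_fctr"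
proof -
  interpret S: category "set_cat U" by (rule category_set_cat)
  interpret P: preord_category "preord_cat U" by (rule preord_category_preord_cat)
  show ?thesis
    by unfold_locales (auto simp: set_cat_def preord_cat_def monotone_maps_def Do_fctr_def
        preorder_on_def refl_on_def intro: transI)
qed

lemma cat_functor_V: "cat_functor (preord_cat U) (set_cat U) V_fctr"
proof -
  interpret S: category "set_cat U" by (rule category_set_cat)
  interpret P: preord_category "preord_cat U" by (rule preord_category_preord_cat)
  show ?thesis
    by unfold_locales (auto simp: set_cat_def preord_cat_def monotone_maps_def V_fctr_def)
qed

text \<open>Both functors keep carriers, so every equation compares restricted identities and
  extensional maps. The counit is monotone because a preorder on A contains
  \<open>Id_on A\<close>.\<close>

lemma adjunction_Do_V:
  "adjunction (set_cat U) (preord_cat U) Do_fctr V_fctr id_on_set id_on_carrier"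
proof -
  interpret Do: cat_functor "set_cat U" "preord_cat U" Do_fctr by (rule cat_functor_Do)
  interpret V: cat_functor "preord_cat U" "set_cat U" V_fctr by (rule cat_functor_V)
  interpret IS: cat_functor "set_cat U" "set_cat U" id_fctr
    by (rule cat_functor_id) unfold_locales
  interpret IP: cat_functor "preord_cat U" "preord_cat U" id_fctr
    by (rule cat_functor_id) unfold_locales
  interpret VD: cat_functor "set_cat U" "set_cat U" "comp_fctr V_fctr Do_fctr"
    by (rule cat_functor_comp[where D = "preord_cat U"]) unfold_locales
  interpret DV: cat_functor "preord_cat U" "preord_cat U" "comp_fctr Do_fctr V_fctr"
    by (rule cat_functor_comp[where D = "set_cat U"]) unfold_locales
  show ?thesis
  proof
    fix X assume "X \<in> Obj (set_cat U)"
    then show "id_on_set X \<in> Hom (set_cat U) (omap id_fctr X) (omap (comp_fctr V_fctr Do_fctr) X)"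
      by (auto simp: set_cat_def id_on_set_def Do_fctr_def V_fctr_def)
  next
    fix Y assume "Y \<in> Obj (preord_cat U)"
    then show "id_on_carrier Y
        \<in> Hom (preord_cat U) (omap (comp_fctr Do_fctr V_fctr) Y) (omap id_fctr Y)"
      by (auto simp: preord_cat_def monotone_maps_def id_on_carrier_def Do_fctr_def V_fctr_def
          preorder_on_def refl_on_def)
  next
    fix X Y f
    assume "f \<in> Hom (set_cat U) X Y"
    then show "Cmp (set_cat U) (omap id_fctr X) (omap id_fctr Y)
        (omap (comp_fctr V_fctr Do_fctr) Y) (id_on_set Y) (amap id_fctr X Y f)
      = Cmp (set_cat U) (omap id_fctr X) (omap (comp_fctr V_fctr Do_fctr) X)
        (omap (comp_fctr V_fctr Do_fctr) Y) (amap (comp_fctr V_fctr Do_fctr) X Y f) (id_on_set X)"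
      by (auto simp: set_cat_def id_on_set_def Do_fctr_def V_fctr_def
          compose_def fun_eq_iff PiE_iff restrict_def)
  next
    fix X Y f
    assume "f \<in> Hom (preord_cat U) X Y"
    then show "Cmp (preord_cat U) (omap (comp_fctr Do_fctr V_fctr) X)
        (omap (comp_fctr Do_fctr V_fctr) Y) (omap id_fctr Y)
        (id_on_carrier Y) (amap (comp_fctr Do_fctr V_fctr) X Y f)
      = Cmp (preord_cat U) (omap (comp_fctr Do_fctr V_fctr) X) (omap id_fctr X)
        (omap id_fctr Y) (amap id_fctr X Y f) (id_on_carrier X)"
      by (auto simp: preord_cat_def monotone_maps_def id_on_carrier_def Do_fctr_def V_fctr_def
          compose_def fun_eq_iff PiE_iff restrict_def split: prod.splits)
  qed (auto simp: set_cat_def preord_cat_def id_on_set_def id_on_carrier_def Do_fctr_def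
      V_fctr_def compose_def restrict_def fun_eq_iff)
qed

section \<open>The self-enrichment of quantale-enriched categories\<close>

lemma bot_mult: "bot * x = (bot :: 'v::comm_quantale)"
  \<comment> \<open>Multiplication by x is a left adjoint, hence preserves the least
    element.\<close>
  using resid_adjoint[of bot x bot] by (simp add: bot_unique)

text \<open>The pointwise bound behind the composition law for the infimum hom-values of
  \<open>v_cat\<close>.\<close>

lemma INF_mult_INF_le:
  fixes f g :: "'a \<Rightarrow> 'v::comm_quantale"
  shows "x \<in> A \<Longrightarrow> (INF x\<in>A. f x) * (INF x\<in>A. g x) \<le> f x * g x"
  by (intro mult_mono_quantale INF_lower)

lemma vcat_category_v_cat: "vcat_category (v_cat U :: (_, _, 'v::comm_quantale) vcat)"
proof
  fix X Y :: "('a, 'v) small_vcat"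
  assume "X \<in> Obj (v_cat U)" "Y \<in> Obj (v_cat U)"
  then show "v_category (Hom (v_cat U) X Y) (HomV (v_cat U) X Y)"
    by (auto simp: v_cat_def v_category_def PiE_iff intro!: INF_greatest split: prod.splits)
      (meson INF_mult_INF_le order_trans)
next
  fix X Y Z :: "('a, 'v) small_vcat" and f g
  assume "f \<in> Hom (v_cat U) X Y" "g \<in> Hom (v_cat U) Y Z"
  moreover obtain A h B k C l where "X = (A, h)" "Y = (B, k)" "Z = (C, l)"
    by (metis surj_pair)
  ultimately show "Cmp (v_cat U) X Y Z g f \<in> Hom (v_cat U) X Z"
    by (auto simp: v_cat_def v_functor_def compose_def Pi_iff PiE_iff)
      (blast intro: order_trans)
next
  fix X Y Z :: "('a, 'v) small_vcat" and f f' g g'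
  assume X: "X \<in> Obj (v_cat U)" and Y: "Y \<in> Obj (v_cat U)" and Z: "Z \<in> Obj (v_cat U)"
    and f: "f \<in> Hom (v_cat U) X Y" "f' \<in> Hom (v_cat U) X Y"
    and g: "g \<in> Hom (v_cat U) Y Z" "g' \<in> Hom (v_cat U) Y Z"
  obtain A h B k C l where XYZ [simp]: "X = (A, h)" "Y = (B, k)" "Z = (C, l)"
    by (metis surj_pair)
  have "(INF y\<in>B. l (g y) (g' y)) * (INF x\<in>A. k (f x) (f' x)) \<le> l (g (f x)) (g' (f' x))"
    if x: "x \<in> A" for x
  proof -
    have B: "f x \<in> B" "f' x \<in> B" and C: "g (f x) \<in> C" "g (f' x) \<in> C" "g' (f' x) \<in> C"
      using x f g by (auto simp: v_cat_def PiE_iff)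
    \<comment> \<open>The infimum over B is evaluated at f' x rather than f x, which gives the path
      from g (f x) through g (f' x) to g' (f' x).\<close>
    have "(INF y\<in>B. l (g y) (g' y)) * (INF x\<in>A. k (f x) (f' x))
      \<le> l (g (f' x)) (g' (f' x)) * k (f x) (f' x)"
      using B x by (intro mult_mono_quantale INF_lower)
    also have "\<dots> \<le> l (g (f' x)) (g' (f' x)) * l (g (f x)) (g (f' x))"
      using B g(1) by (intro mult_mono_quantale) (auto simp: v_cat_def v_functor_def)
    also have "\<dots> \<le> l (g (f x)) (g' (f' x))"
      using C Z by (simp add: v_cat_def v_category_def)
    finally show ?thesis .
  qed
  then show "HomV (v_cat U) Y Z g g' * HomV (v_cat U) X Y f f'
      \<le> HomV (v_cat U) X Z (Cmp (v_cat U) X Y Z g f) (Cmp (v_cat U) X Y Z g' f')"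
    by (auto simp: v_cat_def compose_def intro!: INF_greatest)
qed (auto simp: v_cat_def v_functor_def PiE_iff compose_def extensional_def fun_eq_iff)

section \<open>The adjunction between preorders and quantale-enriched categories\<close>

lemma preord_functor_d:
  "preord_functor (preord_cat U) (underlying_pcat (v_cat U :: (_, _, 'v::comm_quantale) vcat)) d_fctr"
proof -
  interpret P: preord_category "preord_cat U" by (rule preord_category_preord_cat)
  interpret V: preord_category "underlying_pcat (v_cat U :: (_, _, 'v) vcat)"
    by (rule preord_category_underlying) (rule vcat_category_v_cat)
  let ?V = "underlying_pcat (v_cat U :: (_, _, 'v) vcat)"
  \<comment> \<open>A monotone f sends related pairs, of value 1, to related pairs; unrelated pairs
    have value \<open>bot\<close>, which is below everything.\<close>
  have hom: "f \<in> Hom ?V (omap d_fctr X) (omap d_fctr Y)"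
    if "X \<in> Obj (preord_cat U)" "Y \<in> Obj (preord_cat U)" "f \<in> Hom (preord_cat U) X Y" for X Y f
    using that by (auto simp: preord_cat_def v_cat_def monotone_maps_def d_fctr_def v_functor_def
        PiE_iff)
  show ?thesis
  proof
    fix X assume "X \<in> Obj (preord_cat U)"
    \<comment> \<open>In the composition law either both factors are 1 and transitivity applies, or
      one of them is \<open>bot\<close> and so is the product.\<close>
    then show "omap d_fctr X \<in> Obj ?V"
      by (auto simp: preord_cat_def v_cat_def d_fctr_def v_category_def preorder_on_def
          refl_on_def bot_mult mult.commute[of _ bot] dest: transD)
  next
    fix X Y f
    assume "X \<in> Obj (preord_cat U)" "Y \<in> Obj (preord_cat U)" "f \<in> Hom (preord_cat U) X Y"
    then show "amap d_fctr X Y f \<in> Hom ?V (omap d_fctr X) (omap d_fctr Y)"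
      using hom[of X Y f] by (simp add: d_fctr_def)
  next
    fix X Y f g
    assume "X \<in> Obj (preord_cat U)" "Y \<in> Obj (preord_cat U)" "(f, g) \<in> HomOrd (preord_cat U) X Y"
    moreover from this have "f \<in> Hom (preord_cat U) X Y" "g \<in> Hom (preord_cat U) X Y"
      by (auto simp: preord_cat_def)
    \<comment> \<open>Every value under the infimum is 1, since f x lies below g x.\<close>
    ultimately show "(amap d_fctr X Y f, amap d_fctr X Y g) \<in> HomOrd ?V (omap d_fctr X) (omap d_fctr Y)"
      using hom[of X Y f] hom[of X Y g]
      by (auto simp: preord_cat_def v_cat_def d_fctr_def monotone_maps_def underlying_order_def
          PiE_iff intro!: INF_greatest)
  qed (auto simp: preord_cat_def v_cat_def d_fctr_def)
qed

lemma preord_functor_u: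
  "preord_functor (underlying_pcat (v_cat U :: (_, _, 'v::comm_quantale) vcat)) (preord_cat U) u_fctr"
proof -
  interpret P: preord_category "preord_cat U" by (rule preord_category_preord_cat)
  interpret V: preord_category "underlying_pcat (v_cat U :: (_, _, 'v) vcat)"
    by (rule preord_category_underlying) (rule vcat_category_v_cat)
  let ?V = "underlying_pcat (v_cat U :: (_, _, 'v) vcat)"
  have hom: "f \<in> Hom (preord_cat U) (omap u_fctr X) (omap u_fctr Y)"
    if "f \<in> Hom ?V X Y" for X Y f
    using that by (cases X; cases Y) (auto simp: preord_cat_def v_cat_def monotone_maps_def
        u_fctr_def v_functor_def underlying_order_def PiE_iff elim!: order_trans)
  show ?thesis
  proof
    fix X assume "X \<in> Obj ?V"
    then have "fst X \<in> U" "v_category (fst X) (snd X)"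
      by (auto simp: v_cat_def)
    moreover from this have "preorder_on (fst X) (underlying_order (fst X) (snd X))"
      by (intro preorder_on_underlying_order)
    ultimately show "omap u_fctr X \<in> Obj (preord_cat U)"
      by (auto simp: preord_cat_def u_fctr_def split: prod.splits)
  next
    fix X Y f
    assume "f \<in> Hom ?V X Y"
    then show "amap u_fctr X Y f \<in> Hom (preord_cat U) (omap u_fctr X) (omap u_fctr Y)"
      using hom[of f X Y] by (simp add: u_fctr_def)
  next
    fix X Y f g
    assume "(f, g) \<in> HomOrd ?V X Y"
    moreover from this have "f \<in> Hom ?V X Y" "g \<in> Hom ?V X Y"
      by (auto simp: underlying_order_def)
    \<comment> \<open>An infimum lies above 1 exactly when each value does, which is the pointwise
      order.\<close>
    ultimately show "(amap u_fctr X Y f, amap u_fctr X Y g)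
        \<in> HomOrd (preord_cat U) (omap u_fctr X) (omap u_fctr Y)"
      using hom[of f X Y] hom[of g X Y]
      by (cases X; cases Y) (auto simp: preord_cat_def v_cat_def u_fctr_def underlying_order_def PiE_iff le_INF_iff)
  qed (auto simp: preord_cat_def v_cat_def u_fctr_def)
qed

text \<open>For the unit, related pairs have value 1. For the counit, the composite of
  \<open>d_fctr\<close> after \<open>u_fctr\<close> has value 1 only where the given hom-value is at
  least 1, and \<open>bot\<close> elsewhere, so it lies below that hom-value.\<close>

lemma preord_adjunction_d_u:
  "preord_adjunction (preord_cat U) (underlying_pcat (v_cat U :: (_, _, 'v::comm_quantale) vcat))
     d_fctr u_fctr id_on_carrier id_on_carrier"
proof -
  let ?V = "underlying_pcat (v_cat U :: (_, _, 'v) vcat)"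
  interpret d: preord_functor "preord_cat U" ?V d_fctr by (rule preord_functor_d)
  interpret u: preord_functor ?V "preord_cat U" u_fctr by (rule preord_functor_u)
  interpret IP: cat_functor "preord_cat U" "preord_cat U" id_fctr
    by (rule cat_functor_id) unfold_locales
  interpret IV: cat_functor ?V ?V id_fctr
    by (rule cat_functor_id) unfold_locales
  interpret ud: cat_functor "preord_cat U" "preord_cat U" "comp_fctr u_fctr (d_fctr :: (_, _, (_, 'v) small_vcat, _) fctr)"
    by (rule cat_functor_comp[where D = ?V]) unfold_locales
  interpret du: cat_functor ?V ?V "comp_fctr d_fctr u_fctr"
    by (rule cat_functor_comp[where D = "preord_cat U"]) unfold_locales
  show ?thesis
  proof
    fix X assume "X \<in> Obj (preord_cat U)"
    then show "id_on_carrier X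
        \<in> Hom (preord_cat U) (omap id_fctr X) (omap (comp_fctr u_fctr d_fctr) X)"
      by (auto simp: preord_cat_def monotone_maps_def id_on_carrier_def d_fctr_def u_fctr_def
          underlying_order_def preorder_on_def)
  next
    fix Y assume "Y \<in> Obj ?V"
    then show "id_on_carrier Y \<in> Hom ?V (omap (comp_fctr d_fctr u_fctr) Y) (omap id_fctr Y)"
      by (auto simp: v_cat_def v_functor_def id_on_carrier_def d_fctr_def u_fctr_def
          underlying_order_def)
  next
    fix X Y f
    assume "f \<in> Hom (preord_cat U) X Y"
    then show "Cmp (preord_cat U) (omap id_fctr X) (omap id_fctr Y)
        (omap (comp_fctr u_fctr d_fctr) Y) (id_on_carrier Y) (amap id_fctr X Y f)
      = Cmp (preord_cat U) (omap id_fctr X) (omap (comp_fctr u_fctr d_fctr) X)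
        (omap (comp_fctr u_fctr d_fctr) Y) (amap (comp_fctr u_fctr d_fctr) X Y f) (id_on_carrier X)"
      by (auto simp: preord_cat_def monotone_maps_def id_on_carrier_def d_fctr_def u_fctr_def
          compose_def fun_eq_iff PiE_iff restrict_def split: prod.splits)
  next
    fix X Y f
    assume "f \<in> Hom ?V X Y"
    then show "Cmp ?V (omap (comp_fctr d_fctr u_fctr) X) (omap (comp_fctr d_fctr u_fctr) Y)
        (omap id_fctr Y) (id_on_carrier Y) (amap (comp_fctr d_fctr u_fctr) X Y f)
      = Cmp ?V (omap (comp_fctr d_fctr u_fctr) X) (omap id_fctr X)
        (omap id_fctr Y) (amap id_fctr X Y f) (id_on_carrier X)"
      by (auto simp: v_cat_def id_on_carrier_def d_fctr_def u_fctr_def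
          compose_def fun_eq_iff PiE_iff restrict_def split: prod.splits)
  qed (auto simp: preord_cat_def v_cat_def id_on_carrier_def d_fctr_def u_fctr_def compose_def
      restrict_def fun_eq_iff)
qed

section \<open>Lifting both adjunctions to coalgebras\<close>

theorem theorem4p16:
  fixes U :: "'u set set"
    and T :: "('u set, 'u \<Rightarrow> 'u, 'u set, 'u \<Rightarrow> 'u) fctr"
    and That :: "('u preord, 'u \<Rightarrow> 'u, 'u preord, 'u \<Rightarrow> 'u) fctr"
    and Tbar :: "(('u, 'v::comm_quantale) small_vcat, 'u \<Rightarrow> 'u,
                  ('u, 'v) small_vcat, 'u \<Rightarrow> 'u) fctr"
    and \<alpha> :: "'u preord \<Rightarrow> 'u \<Rightarrow> 'u"
    and \<beta> :: "('u, 'v) small_vcat \<Rightarrow> 'u \<Rightarrow> 'u"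
  assumes "(1::'v) \<noteq> bot"
    and "cat_functor (set_cat U) (set_cat U) T"
    and "preord_lifting U T That \<alpha>"
    and "v_cat_lifting U That Tbar \<beta>"
  shows
    "(\<exists>D' V' \<eta>' \<epsilon>'.
        adjunction_lift
          (set_cat U) (preord_cat U) Do_fctr V_fctr id_on_set id_on_carrier
          (coalg (set_cat U) T) (coalg (preord_cat U) That) D' V' \<eta>' \<epsilon>'
          forget_fctr forget_fctr) \<and>
     (\<exists>d' u' \<eta>' \<epsilon>'.
        preord_adjunction_lift
          (preord_cat U) (underlying_pcat (v_cat U :: (_, _, 'v) vcat)) d_fctr u_fctr
          id_on_carrier id_on_carrier
          (preord_coalg (preord_cat U) That) (underlying_pcat (vcat_coalg (v_cat U) Tbar))
          d' u' \<eta>' \<epsilon>'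
          forget_fctr forget_fctr)"
proof
  interpret T: cat_functor "set_cat U" "set_cat U" T by fact
  interpret A: preord_lifting U T That \<alpha> by fact
  interpret B: v_cat_lifting U That Tbar \<beta> by fact
  \<comment> \<open>\<alpha> already runs from S G to G R for S = \<open>T\<close>, G =
    \<open>V_fctr\<close> and R = \<open>That\<close>, as required of \<gamma>.\<close>
  obtain \<alpha>' where "adjunction_intertwining (set_cat U) (preord_cat U) Do_fctr V_fctr id_on_set
      id_on_carrier T That \<alpha> \<alpha>'"
    by (rule intertwining_of_nat_iso[OF adjunction_Do_V T.cat_functor_axioms
        A.That.cat_functor_axioms A.iso.nat_iso_axioms])
  then show "\<exists>D' V' \<eta>' \<epsilon>'.
        adjunction_lift
          (set_cat U) (preord_cat U) Do_fctr V_fctr id_on_set id_on_carrier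
          (coalg (set_cat U) T) (coalg (preord_cat U) That) D' V' \<eta>' \<epsilon>'
          forget_fctr forget_fctr"
    by (intro exI) (rule adjunction_intertwining.adjunction_lift_coalg)

  let ?Vcat = "underlying_pcat (v_cat U :: (_, _, 'v) vcat)"
  have adj: "preord_adjunction (preord_cat U) ?Vcat d_fctr u_fctr id_on_carrier id_on_carrier"
    by (rule preord_adjunction_d_u)
  have Tbar: "preord_functor ?Vcat ?Vcat Tbar"
    by (rule preord_functor_underlying) (rule B.Tbar.vcat_functor_axioms)
  \<comment> \<open>\<beta> runs from G R to S G for G = \<open>u_fctr\<close>, R =
    \<open>Tbar\<close> and S = \<open>That\<close>, so its inverse takes the role of
    \<gamma>.\<close>
  obtain \<beta>' where \<beta>':
    "nat_iso ?Vcat (preord_cat U) (comp_fctr That u_fctr) (comp_fctr u_fctr Tbar) \<beta>'"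
    by (rule nat_iso_inverse[OF B.iso.nat_iso_axioms]) (rule that)
  obtain \<beta>'' where "adjunction_intertwining (preord_cat U) ?Vcat d_fctr u_fctr id_on_carrier
      id_on_carrier That Tbar \<beta>' \<beta>''"
    by (rule intertwining_of_nat_iso[OF preord_adjunction.axioms(1)[OF adj]
        A.That.cat_functor_axioms preord_functor.axioms(1)[OF Tbar] \<beta>'])
  then show "\<exists>d' u' \<eta>' \<epsilon>'.
        preord_adjunction_lift
          (preord_cat U) (underlying_pcat (v_cat U :: (_, _, 'v) vcat)) d_fctr u_fctr
          id_on_carrier id_on_carrier
          (preord_coalg (preord_cat U) That) (underlying_pcat (vcat_coalg (v_cat U) Tbar))
          d' u' \<eta>' \<epsilon>'
          forget_fctr forget_fctr"
    unfolding underlying_pcat_vcat_coalg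
    by (rule preord_adjunction_lift_coalg[OF adj A.That.preord_functor_axioms Tbar])
qed

end
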